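(* Let $E$ be a Montel space and let $T\in\mathcal{L}(E)$. (a) $T$ is mean ergodic if and only if $T$ is uniformly mean ergodic. (b) The following are equivalent: (i) $T$ is Cesàro bounded and $\lim_{n\to\infty}\frac{1}{n}T^n x=0$ in $E$ for every $x\in E$. (ii) $T$ is mean ergodic on $E$. (iii) $T$ is uniformly mean ergodic on $E$. (iv) $T^t$ is mean ergodic on $(E',\beta(E',E))$. (v) $T^t$ is uniformly mean ergodic on $(E',\beta(E',E))$. (vi) $T^t$ is Cesàro bounded on $(E',\beta(E',E))$ and $\lim_{n\to\infty}\frac{1}{n}(T^t)^n u=0$ in $(E',\beta(E',E))$ for every $u\in E'$.
   Context: For a locally convex Hausdorff space $F$, $\mathcal{L}(F)$ denotes the continuous linear operators on $F$. For $S\in\mathcal{L}(F)$ and $n\in\mathbb{N}=\{1,2,\dots\}$ the $n$-th Cesàro mean is $S^{[n]}=\frac{1}{n}\sum_{m=1}^{n}S^m$. $S$ is Cesàro bounded if $\{S^{[n]}: n\in\mathbb{N}\}$ is an equicontinuous subset of $\mathcal{L}(F)$. $S$ is mean ergodic if there is $P\in\mathcal{L}(F)$ with $\lim_{n\to\infty}S^{[n]}x=Px$ for every $x\in F$; $S$ is uniformly mean ergodic if in addition this convergence is uniform on bounded subsets of $F$. $E'$ is the topological dual of $E$, $\beta(E',E)$ the strong dual topology (uniform convergence on bounded subsets of $E$), and $T^t:E'\to E'$, $T^t u=u\circ T$, is the transpose of $T$. A Montel space is a barrelled locally convex Hausdorff space in which every bounded set is relatively compact. *)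

theory Defs
  imports "HOL-Analysis.Analysis" "HOL-Library.Function_Algebras"
begin

text \<open>
  A space over the scalar field \<open>'k\<close> is given by a scalar multiplication on an ambient vector
  space \<open>'a\<close> and a topology \<open>X\<close> whose carrier \<^term>\<open>topspace X\<close> is a linear subspace of
  \<open>'a\<close>.  Type classes are not sufficient here, since a space and its dual, with its own
  topology, have to be treated by the same notions.
\<close>

section \<open>Scalars\<close>

text \<open>The scalar field is the reals or the complex numbers; in the second case \<open>j\<close> is the
  imaginary unit.  Multiplicativity of the norm then forces it to be the usual absolute value.\<close>

class real_or_complex = real_normed_field +
  assumes real_or_complex:
    "(\<forall>x. \<exists>a. x = a *\<^sub>R 1) \<or>
     (\<exists>j. j * j = - 1 \<and> (\<forall>x. \<exists>a b. x = a *\<^sub>R 1 + b *\<^sub>R j))"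

instance real :: real_or_complex
  by standard auto

instance complex :: real_or_complex
proof
  have "\<exists>a b. x = a *\<^sub>R 1 + b *\<^sub>R \<i>" for x
    by (intro exI[of _ "Re x"] exI[of _ "Im x"]) (simp add: complex_eq_iff)
  then show "(\<forall>x::complex. \<exists>a. x = a *\<^sub>R 1) \<or>
     (\<exists>j::complex. j * j = - 1 \<and> (\<forall>x. \<exists>a b. x = a *\<^sub>R 1 + b *\<^sub>R j))"
    using i_squared by blast
qed

section \<open>Locally convex Hausdorff spaces\<close>

definition scale_convex :: "('k::real_or_complex \<Rightarrow> 'a::ab_group_add \<Rightarrow> 'a) \<Rightarrow> 'a set \<Rightarrow> bool"
  where "scale_convex smul C \<longleftrightarrow>
    (\<forall>x\<in>C. \<forall>y\<in>C. \<forall>t::real. 0 \<le> t \<and> t \<le> 1 \<longrightarrow>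
       smul (of_real t) x + smul (of_real (1 - t)) y \<in> C)"

definition scale_balanced :: "('k::real_or_complex \<Rightarrow> 'a::ab_group_add \<Rightarrow> 'a) \<Rightarrow> 'a set \<Rightarrow> bool"
  where "scale_balanced smul C \<longleftrightarrow> (\<forall>x\<in>C. \<forall>c. norm c \<le> 1 \<longrightarrow> smul c x \<in> C)"

definition absorbs :: "('k::real_or_complex \<Rightarrow> 'a::ab_group_add \<Rightarrow> 'a) \<Rightarrow> 'a set \<Rightarrow> 'a set \<Rightarrow> bool"
  where "absorbs smul V B \<longleftrightarrow> (\<exists>r>0. \<forall>c. r \<le> norm c \<longrightarrow> B \<subseteq> smul c ` V)"

definition lc_hausdorff_space ::
    "('k::real_or_complex \<Rightarrow> 'a::ab_group_add \<Rightarrow> 'a) \<Rightarrow> 'a topology \<Rightarrow> bool"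
  where "lc_hausdorff_space smul X \<longleftrightarrow>
    vector_space smul \<and>
    module.subspace smul (topspace X) \<and>
    continuous_map (prod_topology X X) X (\<lambda>(x, y). x + y) \<and>
    continuous_map (prod_topology euclidean X) X (\<lambda>(c, x). smul c x) \<and>
    Hausdorff_space X \<and>
    neighbourhood_base_at 0 (scale_convex smul) X"

definition zero_nhd :: "'a::zero topology \<Rightarrow> 'a set \<Rightarrow> bool"
  where "zero_nhd X V \<longleftrightarrow> V \<subseteq> topspace X \<and> (\<exists>U. openin X U \<and> 0 \<in> U \<and> U \<subseteq> V)"

definition vn_bounded ::
    "('k::real_or_complex \<Rightarrow> 'a::ab_group_add \<Rightarrow> 'a) \<Rightarrow> 'a topology \<Rightarrow> 'a set \<Rightarrow> bool"
  where "vn_bounded smul X B \<longleftrightarrow>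
    B \<subseteq> topspace X \<and> (\<forall>V. zero_nhd X V \<longrightarrow> absorbs smul V B)"

definition barrel ::
    "('k::real_or_complex \<Rightarrow> 'a::ab_group_add \<Rightarrow> 'a) \<Rightarrow> 'a topology \<Rightarrow> 'a set \<Rightarrow> bool"
  where "barrel smul X B \<longleftrightarrow>
    closedin X B \<and> scale_convex smul B \<and> scale_balanced smul B \<and>
    (\<forall>x\<in>topspace X. absorbs smul B {x})"

definition barrelled_space ::
    "('k::real_or_complex \<Rightarrow> 'a::ab_group_add \<Rightarrow> 'a) \<Rightarrow> 'a topology \<Rightarrow> bool"
  where "barrelled_space smul X \<longleftrightarrow>
    lc_hausdorff_space smul X \<and> (\<forall>B. barrel smul X B \<longrightarrow> zero_nhd X B)"

definition montel_space ::
    "('k::real_or_complex \<Rightarrow> 'a::ab_group_add \<Rightarrow> 'a) \<Rightarrow> 'a topology \<Rightarrow> bool"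
  where "montel_space smul X \<longleftrightarrow>
    barrelled_space smul X \<and> (\<forall>B. vn_bounded smul X B \<longrightarrow> compactin X (X closure_of B))"

section \<open>Operators, Cesaro means and ergodicity\<close>

definition linear_map_on :: "'a set \<Rightarrow> ('k \<Rightarrow> 'a::plus \<Rightarrow> 'a) \<Rightarrow> ('k \<Rightarrow> 'b::plus \<Rightarrow> 'b) \<Rightarrow> ('a \<Rightarrow> 'b) \<Rightarrow> bool"
  where "linear_map_on C scale1 scale2 f \<longleftrightarrow>
    (\<forall>x\<in>C. \<forall>y\<in>C. f (x + y) = f x + f y) \<and>
    (\<forall>c. \<forall>x\<in>C. f (scale1 c x) = scale2 c (f x))"

text \<open>Only the values of an operator on \<^term>\<open>topspace X\<close> are relevant.\<close>

definition continuous_operators ::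
    "('k::real_or_complex \<Rightarrow> 'a::ab_group_add \<Rightarrow> 'a) \<Rightarrow> 'a topology \<Rightarrow> ('a \<Rightarrow> 'a) set"
  where "continuous_operators smul X =
    {S. linear_map_on (topspace X) smul smul S \<and> continuous_map X X S}"

definition equicontinuous_operators ::
    "('k::real_or_complex \<Rightarrow> 'a::ab_group_add \<Rightarrow> 'a) \<Rightarrow> 'a topology \<Rightarrow> ('a \<Rightarrow> 'a) set \<Rightarrow> bool"
  where "equicontinuous_operators smul X H \<longleftrightarrow>
    H \<subseteq> continuous_operators smul X \<and>
    (\<forall>V. zero_nhd X V \<longrightarrow> (\<exists>U. zero_nhd X U \<and> (\<forall>S\<in>H. S ` U \<subseteq> V)))"

definition cesaro_mean ::
    "('k::real_or_complex \<Rightarrow> 'a::ab_group_add \<Rightarrow> 'a) \<Rightarrow> ('a \<Rightarrow> 'a) \<Rightarrow> nat \<Rightarrow> 'a \<Rightarrow> 'a"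
  where "cesaro_mean smul S n x = smul (1 / of_nat n) (\<Sum>m=1..n. (S ^^ m) x)"

definition cesaro_bounded ::
    "('k::real_or_complex \<Rightarrow> 'a::ab_group_add \<Rightarrow> 'a) \<Rightarrow> 'a topology \<Rightarrow> ('a \<Rightarrow> 'a) \<Rightarrow> bool"
  where "cesaro_bounded smul X S \<longleftrightarrow>
    equicontinuous_operators smul X {cesaro_mean smul S n |n. n \<ge> 1}"

definition mean_ergodic ::
    "('k::real_or_complex \<Rightarrow> 'a::ab_group_add \<Rightarrow> 'a) \<Rightarrow> 'a topology \<Rightarrow> ('a \<Rightarrow> 'a) \<Rightarrow> bool"
  where "mean_ergodic smul X S \<longleftrightarrow>
    (\<exists>P\<in>continuous_operators smul X. \<forall>x\<in>topspace X.
       limitin X (\<lambda>n. cesaro_mean smul S n x) (P x) sequentially)"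

definition uniformly_mean_ergodic ::
    "('k::real_or_complex \<Rightarrow> 'a::ab_group_add \<Rightarrow> 'a) \<Rightarrow> 'a topology \<Rightarrow> ('a \<Rightarrow> 'a) \<Rightarrow> bool"
  where "uniformly_mean_ergodic smul X S \<longleftrightarrow>
    (\<exists>P\<in>continuous_operators smul X.
       (\<forall>x\<in>topspace X. limitin X (\<lambda>n. cesaro_mean smul S n x) (P x) sequentially) \<and>
       (\<forall>B V. vn_bounded smul X B \<and> zero_nhd X V \<longrightarrow>
          (\<forall>\<^sub>F n in sequentially. \<forall>x\<in>B. cesaro_mean smul S n x - P x \<in> V)))"

section \<open>Strong dual and transpose\<close>

text \<open>Functionals are normalised to vanish outside \<^term>\<open>topspace X\<close>, so that a functional on
  the carrier corresponds to exactly one function on the ambient type.\<close>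

definition dual_space ::
    "('k::real_or_complex \<Rightarrow> 'a::ab_group_add \<Rightarrow> 'a) \<Rightarrow> 'a topology \<Rightarrow> ('a \<Rightarrow> 'k) set"
  where "dual_space smul X =
    {u. linear_map_on (topspace X) smul (*) u \<and> continuous_map X euclidean u \<and>
        (\<forall>x. x \<notin> topspace X \<longrightarrow> u x = 0)}"

definition dual_scale :: "'k::real_or_complex \<Rightarrow> ('a \<Rightarrow> 'k) \<Rightarrow> ('a \<Rightarrow> 'k)"
  where "dual_scale c u = (\<lambda>x. c * u x)"

definition dual_ball ::
    "('k::real_or_complex \<Rightarrow> 'a::ab_group_add \<Rightarrow> 'a) \<Rightarrow> 'a topology \<Rightarrow>
     ('a \<Rightarrow> 'k) \<Rightarrow> 'a set \<Rightarrow> real \<Rightarrow> ('a \<Rightarrow> 'k) set"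
  where "dual_ball smul X u B e = {v \<in> dual_space smul X. \<forall>x\<in>B. norm (v x - u x) \<le> e}"

definition strong_dual ::
    "('k::real_or_complex \<Rightarrow> 'a::ab_group_add \<Rightarrow> 'a) \<Rightarrow> 'a topology \<Rightarrow> ('a \<Rightarrow> 'k) topology"
  where "strong_dual smul X = topology (\<lambda>W. W \<subseteq> dual_space smul X \<and>
    (\<forall>u\<in>W. \<exists>B e. vn_bounded smul X B \<and> e > 0 \<and> dual_ball smul X u B e \<subseteq> W))"

lemma vn_bounded_empty: "vn_bounded smul X {}"
  unfolding vn_bounded_def absorbs_def by (auto intro: exI[of _ 1])

lemma vn_bounded_Un:
  assumes "vn_bounded smul X A" "vn_bounded smul X B"
  shows "vn_bounded smul X (A \<union> B)"
  unfolding vn_bounded_def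
proof (intro conjI allI impI)
  show "A \<union> B \<subseteq> topspace X"
    using assms by (auto simp: vn_bounded_def)
  fix V assume "zero_nhd X V"
  then have "absorbs smul V A" "absorbs smul V B"
    using assms by (auto simp: vn_bounded_def)
  then obtain r s where "r > 0" "\<forall>c. r \<le> norm c \<longrightarrow> A \<subseteq> smul c ` V"
    and "s > 0" "\<forall>c. s \<le> norm c \<longrightarrow> B \<subseteq> smul c ` V"
    unfolding absorbs_def by blast
  then show "absorbs smul V (A \<union> B)"
    unfolding absorbs_def by (intro exI[of _ "max r s"]) simp
qed

lemma openin_strong_dual:
  "openin (strong_dual smul X) W \<longleftrightarrow> W \<subseteq> dual_space smul X \<and>
    (\<forall>u\<in>W. \<exists>B e. vn_bounded smul X B \<and> e > 0 \<and> dual_ball smul X u B e \<subseteq> W)"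
proof -
  let ?P = "\<lambda>W. W \<subseteq> dual_space smul X \<and>
    (\<forall>u\<in>W. \<exists>B e. vn_bounded smul X B \<and> e > 0 \<and> dual_ball smul X u B e \<subseteq> W)"
  have "istopology ?P"
    unfolding istopology_def
  proof (rule conjI; intro allI impI)
    fix S T assume S: "?P S" and T: "?P T"
    have "\<exists>B e. vn_bounded smul X B \<and> e > 0 \<and> dual_ball smul X u B e \<subseteq> S \<inter> T"
      if u: "u \<in> S \<inter> T" for u
    proof -
      obtain A d where A: "vn_bounded smul X A" "d > 0" "dual_ball smul X u A d \<subseteq> S"
        using S u by blast
      obtain B e where B: "vn_bounded smul X B" "e > 0" "dual_ball smul X u B e \<subseteq> T"
        using T u by blast
      have "dual_ball smul X u (A \<union> B) (min d e) \<subseteq> dual_ball smul X u A d \<inter> dual_ball smul X u B e"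
        by (auto simp: dual_ball_def)
      then show ?thesis
        using A B vn_bounded_Un[OF A(1) B(1)]
        by (intro exI[of _ "A \<union> B"] exI[of _ "min d e"]) auto
    qed
    then show "?P (S \<inter> T)" using S by blast
  next
    fix K assume K: "\<forall>S\<in>K. ?P S"
    have "\<exists>B e. vn_bounded smul X B \<and> e > 0 \<and> dual_ball smul X u B e \<subseteq> \<Union>K" if u: "u \<in> \<Union>K" for u
    proof -
      obtain S where "S \<in> K" "u \<in> S" using u by blast
      then obtain B e where "vn_bounded smul X B" "e > 0" "dual_ball smul X u B e \<subseteq> S"
        using K by blast
      with \<open>S \<in> K\<close> show ?thesis by blast
    qed
    then show "?P (\<Union>K)" using K by blast
  qed
  then show ?thesis
    by (simp add: strong_dual_def topology_inverse')
qed

lemma topspace_strong_dual [simp]: "topspace (strong_dual smul X) = dual_space smul X"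
proof -
  have "\<exists>B e. vn_bounded smul X B \<and> e > 0 \<and> dual_ball smul X u B e \<subseteq> dual_space smul X" for u
    using vn_bounded_empty[of smul X]
    by (intro exI[of _ "{}"] exI[of _ 1]) (simp add: dual_ball_def)
  then have "openin (strong_dual smul X) (dual_space smul X)"
    by (simp add: openin_strong_dual)
  then show ?thesis
    using openin_subset openin_strong_dual[of smul X "topspace (strong_dual smul X)"] by blast
qed

definition transpose_operator ::
    "'a topology \<Rightarrow> ('a \<Rightarrow> 'a) \<Rightarrow> ('a \<Rightarrow> 'k::real_or_complex) \<Rightarrow> ('a \<Rightarrow> 'k)"
  where "transpose_operator X T u = (\<lambda>x. if x \<in> topspace X then u (T x) else 0)"

end

theory Submission
  imports Defs
begin

text \<open>
  Write \<open>M\<^sub>n\<close> for the Cesaro means of \<open>T\<close>.  If they are equicontinuous and \<open>T\<^sup>n x / n\<close> tends to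
  \<open>0\<close>, then \<open>(M\<^sub>n x)\<close> is relatively compact by the Montel property, so Yosida's argument yields
  convergence, which equicontinuity makes uniform on totally bounded and hence on all bounded sets.
  Conversely, convergence gives equicontinuity since the space is barrelled.  Uniform convergence on
  bounded sets passes to the transpose, because strongly bounded sets of functionals on a barrelled
  space are equicontinuous.  Each of the conditions on the transpose implies that the sequences
  \<open>(M\<^sub>n x)\<close> are weakly bounded, hence bounded by Mackey's theorem, and that the sequences
  \<open>(T\<^sup>n x / n)\<close> are weakly null, hence null because they lie in compact sets.
\<close>

section \<open>Scalars\<close>

text \<open>The conditions on the transpose are read off one point at a time: they are reduced to
  the scalar sequences u(M_n x) and u(T^n x / n), and Mackey's theorem together with separation of
  points by the dual leads from these back to E. Both results rest on a Hahn--Banach theorem that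
  attains a prescribed value at one point. It is proved for real scalars on a subspace of the
  ambient type, since carrier and topology are data and not a type, and then transferred to the
  abstract scalar field. The norm of that field is known only through its axioms, so the estimate of
  the norm of a + b j from below by |a| has to come first. On E, topological statements are
  translated into statements about continuous seminorms, where sums replace finite families and
  multiples replace radii. Division by zero makes the mean of index 0 equal to 0; estimates that are
  meant for indices from 1 on are extended to it where whole sequences are needed.\<close>

lemma imaginary_unit_mult:
  fixes j :: "'k::real_normed_field"
  assumes j: "j * j = -1"
  shows "(a *\<^sub>R 1 + b *\<^sub>R j) * (c *\<^sub>R 1 + d *\<^sub>R j)
    = (a * c - b * d) *\<^sub>R 1 + (a * d + b * c) *\<^sub>R j"
proof -
  have "(a *\<^sub>R 1 + b *\<^sub>R j) * (c *\<^sub>R 1 + d *\<^sub>R j)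
    = (a * c) *\<^sub>R 1 + (a * d + b * c) *\<^sub>R j + (b * d) *\<^sub>R (j * j)"
    by (simp add: algebra_simps)
  then show ?thesis by (simp add: j algebra_simps)
qed

text \<open>The points a + b j with a^2 + b^2 = 1 are closed under multiplication, and each has norm
  at most |a| + |b|, hence at most 2. A norm above 1 would make the powers of such a point exceed
  this bound.\<close>

lemma norm_unit_circle_le_1:
  fixes j :: "'k::real_normed_field"
  assumes j: "j * j = -1" and ab: "a\<^sup>2 + b\<^sup>2 = 1"
  shows "norm (a *\<^sub>R 1 + b *\<^sub>R j) \<le> 1"
proof (rule ccontr)
  let ?z = "a *\<^sub>R 1 + b *\<^sub>R j"
  assume "\<not> norm ?z \<le> 1"
  then have gt: "1 < norm ?z" by simp
  have "(norm j)\<^sup>2 = 1"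
    using j by (metis norm_mult norm_minus_cancel norm_one power2_eq_square)
  then have nj: "norm j = 1"
    by (metis abs_norm_cancel abs_square_eq_1)
  have pow: "\<exists>c d. ?z ^ n = c *\<^sub>R 1 + d *\<^sub>R j \<and> c\<^sup>2 + d\<^sup>2 = 1" for n
  proof (induction n)
    case 0
    show ?case by (intro exI[of _ 1] exI[of _ 0]) simp
  next
    case (Suc n)
    then obtain c d where cd: "?z ^ n = c *\<^sub>R 1 + d *\<^sub>R j" "c\<^sup>2 + d\<^sup>2 = 1" by blast
    have "?z ^ Suc n = (a * c - b * d) *\<^sub>R 1 + (a * d + b * c) *\<^sub>R j"
      using imaginary_unit_mult[OF j] cd by simp
    moreover have "(a * c - b * d)\<^sup>2 + (a * d + b * c)\<^sup>2 = (a\<^sup>2 + b\<^sup>2) * (c\<^sup>2 + d\<^sup>2)"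
      by (simp add: power2_eq_square algebra_simps)
    ultimately show ?case using ab cd by (metis mult_1)
  qed
  obtain n where n: "2 < norm ?z ^ n"
    using real_arch_pow[OF gt] by blast
  obtain c d where cd: "?z ^ n = c *\<^sub>R 1 + d *\<^sub>R j" "c\<^sup>2 + d\<^sup>2 = 1" using pow by blast
  have "c\<^sup>2 \<le> 1" "d\<^sup>2 \<le> 1"
    using cd(2) zero_le_power2[of c] zero_le_power2[of d] by linarith+
  then have "\<bar>c\<bar> \<le> 1" "\<bar>d\<bar> \<le> 1"
    by (simp_all add: abs_square_le_1)
  moreover have "norm (?z ^ n) \<le> \<bar>c\<bar> + \<bar>d\<bar>"
    unfolding cd(1) using norm_triangle_ineq[of "c *\<^sub>R 1" "d *\<^sub>R j"] nj by simp
  ultimately show False using n by (simp add: norm_power)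
qed

text \<open>On the unit circle the conjugate is the inverse, so the upper bound for the norm of the
  conjugate becomes a lower bound for the norm of the point. Rescaling by s = sqrt (a^2 + b^2) gives
  the lower bound s, and s is at least |a|.\<close>

lemma abs_real_part_le_norm:
  fixes j :: "'k::real_normed_field"
  assumes j: "j * j = -1"
  shows "\<bar>a\<bar> \<le> norm (a *\<^sub>R 1 + b *\<^sub>R j)"
proof (cases "a\<^sup>2 + b\<^sup>2 = 0")
  case True
  then show ?thesis by (simp add: sum_power2_eq_zero_iff)
next
  case False
  define s where "s = sqrt (a\<^sup>2 + b\<^sup>2)"
  have s: "s > 0" "s\<^sup>2 = a\<^sup>2 + b\<^sup>2"
    using False by (auto simp: s_def sum_power2_gt_zero_iff)
  have one: "(a / s)\<^sup>2 + (b / s)\<^sup>2 = 1"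
    using s False by (simp add: power_divide add_divide_distrib[symmetric])
  let ?z = "(a / s) *\<^sub>R 1 + (b / s) *\<^sub>R j" and ?w = "(a / s) *\<^sub>R 1 + (- b / s) *\<^sub>R j"
  have "?z * ?w = ((a / s)\<^sup>2 + (b / s)\<^sup>2) *\<^sub>R 1"
    unfolding imaginary_unit_mult[OF j] by (simp add: power2_eq_square)
  then have "norm ?z * norm ?w = 1"
    using one by (metis norm_mult norm_one scaleR_one)
  moreover have "norm ?w \<le> 1"
    using norm_unit_circle_le_1[OF j, of "a / s" "- b / s"] one by simp
  ultimately have "1 \<le> norm ?z"
    by (metis mult.right_neutral mult_left_mono norm_ge_zero)
  moreover have "a *\<^sub>R 1 + b *\<^sub>R j = s *\<^sub>R ?z"
    using s by (simp add: scaleR_add_right)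
  ultimately have "s \<le> norm (a *\<^sub>R 1 + b *\<^sub>R j)"
    using s by simp
  moreover have "\<bar>a\<bar> \<le> s"
    by (simp add: s_def)
  ultimately show ?thesis by simp
qed

section \<open>The Hahn--Banach theorem\<close>

text \<open>One-sided homogeneity suffices: it implies equality for nonnegative factors.\<close>

definition sublinear_on :: "'a set \<Rightarrow> (real \<Rightarrow> 'a::ab_group_add \<Rightarrow> 'a) \<Rightarrow> ('a \<Rightarrow> real) \<Rightarrow> bool"
  where "sublinear_on S sc q \<longleftrightarrow>
    (\<forall>x\<in>S. \<forall>y\<in>S. q (x + y) \<le> q x + q y) \<and> (\<forall>t\<ge>0. \<forall>x\<in>S. q (sc t x) \<le> t * q x)"

text \<open>Carriers over either scalar field become instances by restricting the scalars to the
  reals.\<close>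

locale real_carrier = vector_space scale
  for scale :: "real \<Rightarrow> 'a::ab_group_add \<Rightarrow> 'a" +
  fixes S :: "'a set"
  assumes subspace_S: "subspace S"
begin

lemma carrier_closed [simp, intro]:
  "0 \<in> S" "x \<in> S \<Longrightarrow> y \<in> S \<Longrightarrow> x + y \<in> S" "x \<in> S \<Longrightarrow> scale t x \<in> S" "x \<in> S \<Longrightarrow> - x \<in> S"
  using subspace_S subspace_0 subspace_add subspace_scale subspace_neg by blast+

lemma sublinear_add: "sublinear_on S scale q \<Longrightarrow> x \<in> S \<Longrightarrow> y \<in> S \<Longrightarrow> q (x + y) \<le> q x + q y"
  by (simp add: sublinear_on_def)

lemma sublinear_scale_le:
  "sublinear_on S scale q \<Longrightarrow> x \<in> S \<Longrightarrow> 0 \<le> t \<Longrightarrow> q (scale t x) \<le> t * q x"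
  by (simp add: sublinear_on_def)

lemma sublinear_0:
  assumes "sublinear_on S scale q"
  shows "q 0 = 0"
  using sublinear_add[OF assms, of 0 0] sublinear_scale_le[OF assms, of 0 0] by simp

lemma sublinear_scale:
  assumes q: "sublinear_on S scale q" and "x \<in> S" "0 \<le> t"
  shows "q (scale t x) = t * q x"
proof (cases "t = 0")
  case True
  then show ?thesis using sublinear_0[OF q] by simp
next
  case False
  then have t: "t > 0" using assms by simp
  have "q (scale (1 / t) (scale t x)) \<le> 1 / t * q (scale t x)"
    using t assms by (intro sublinear_scale_le) auto
  then have "t * q x \<le> q (scale t x)"
    using t by (simp add: field_simps)
  then show ?thesis using sublinear_scale_le[OF q assms(2,3)] by simp
qed

lemma sublinear_neg:
  assumes q: "sublinear_on S scale q" and "x \<in> S"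
  shows "- q (- x) \<le> q x"
  using sublinear_add[OF q, of x "- x"] sublinear_0[OF q] assms by simp

text \<open>The choice t = 0 puts this below \<open>q\<close>, and t = 1 at the point
  \<open>- y\<close> bounds it by \<open>- q y\<close>. A linear functional below it therefore
  agrees with \<open>q\<close> at \<open>y\<close>.\<close>

definition directional :: "('a \<Rightarrow> real) \<Rightarrow> 'a \<Rightarrow> 'a \<Rightarrow> real"
  where "directional q y x = (if x \<in> S then INF t\<in>{0..}. q (x + scale t y) - t * q y else 0)"

text \<open>Subadditivity of \<open>q\<close> bounds the infima below by \<open>- q (- x)\<close>.
  Parameters s for x and t for z combine to s + t for x + z, which gives subadditivity after two
  infima; for s > 0, replacing t by s t gives homogeneity.\<close>

lemma
  assumes q: "sublinear_on S scale q" and y: "y \<in> S"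
  shows directional_le: "\<And>x t. x \<in> S \<Longrightarrow> 0 \<le> t \<Longrightarrow> directional q y x \<le> q (x + scale t y) - t * q y"
    and sublinear_directional: "sublinear_on S scale (directional q y)"
proof -
  have bdd: "bdd_below ((\<lambda>t. q (x + scale t y) - t * q y) ` {0..})" if x: "x \<in> S" for x
  proof (rule bdd_belowI2)
    fix t :: real assume "t \<in> {0..}"
    then have "t * q y = q (scale t y)" using sublinear_scale[OF q y] by simp
    also have "\<dots> \<le> q (x + scale t y) + q (- x)"
      using sublinear_add[OF q, of "x + scale t y" "- x"] x y by simp
    finally show "- q (- x) \<le> q (x + scale t y) - t * q y" by simp
  qed
  show le: "directional q y x \<le> q (x + scale t y) - t * q y" if "x \<in> S" "0 \<le> t" for x t
    unfolding directional_def using that by (auto intro!: cINF_lower bdd)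
  show "sublinear_on S scale (directional q y)"
    unfolding sublinear_on_def
  proof (intro conjI ballI allI impI)
    fix x z assume x: "x \<in> S" and z: "z \<in> S"
    have *: "directional q y (x + z) \<le> (q (x + scale s y) - s * q y) + (q (z + scale t y) - t * q y)"
      if "0 \<le> s" "0 \<le> t" for s t
    proof -
      have "directional q y (x + z) \<le> q (x + z + scale (s + t) y) - (s + t) * q y"
        using that x z by (intro le) auto
      also have "x + z + scale (s + t) y = (x + scale s y) + (z + scale t y)"
        by (simp add: scale_left_distrib)
      also have "q \<dots> \<le> q (x + scale s y) + q (z + scale t y)"
        using x y z by (intro sublinear_add[OF q]) auto
      finally show ?thesis by (simp add: algebra_simps)
    qed
    have "directional q y (x + z) - (q (x + scale s y) - s * q y) \<le> directional q y z"
      if "0 \<le> s" for s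
      unfolding directional_def[of q y z] if_P[OF z]
      by (intro cINF_greatest) (use *[OF that] in \<open>auto simp: algebra_simps\<close>)
    then have "directional q y (x + z) - directional q y z \<le> directional q y x"
      unfolding directional_def[of q y x] if_P[OF x] by (intro cINF_greatest) (auto simp: algebra_simps)
    then show "directional q y (x + z) \<le> directional q y x + directional q y z" by simp
  next
    fix s :: real and x assume s: "0 \<le> s" and x: "x \<in> S"
    show "directional q y (scale s x) \<le> s * directional q y x"
    proof (cases "s = 0")
      case True
      then show ?thesis using le[of 0 0] sublinear_0[OF q] by simp
    next
      case False
      with s have s: "s > 0" by simp
      have "directional q y (scale s x) / s \<le> q (x + scale t y) - t * q y" if t: "0 \<le> t" for t
      proof -
        have "directional q y (scale s x) \<le> q (scale s x + scale (s * t) y) - (s * t) * q y"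
          using s t x by (intro le) auto
        also have "scale s x + scale (s * t) y = scale s (x + scale t y)"
          by (simp add: scale_right_distrib)
        also have "q \<dots> = s * q (x + scale t y)"
          using s x y by (intro sublinear_scale[OF q]) auto
        finally show ?thesis using s by (simp add: field_simps)
      qed
      then have "directional q y (scale s x) / s \<le> directional q y x"
        unfolding directional_def[of q y x] if_P[OF x] by (intro cINF_greatest) auto
      then show ?thesis using s by (simp add: field_simps)
    qed
  qed
qed

text \<open>Subadditivity of the infimum comes from the chain condition: when \<open>q\<close> is
  evaluated at x and \<open>r\<close> at z, the smaller of the two functionals is below both values
  at once. The common bound \<open>p\<close> keeps the infimum above
  \<open>- p (- x)\<close>.\<close>

lemma sublinear_INF_chain:
  assumes C: "C \<noteq> {}" and sub: "\<And>q. q \<in> C \<Longrightarrow> sublinear_on S scale q"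
    and chain: "\<And>q r. q \<in> C \<Longrightarrow> r \<in> C \<Longrightarrow> q \<le> r \<or> r \<le> q"
    and le: "\<And>q x. q \<in> C \<Longrightarrow> x \<in> S \<Longrightarrow> q x \<le> p x"
  shows "x \<in> S \<Longrightarrow> bdd_below ((\<lambda>q. q x) ` C)"
    and "sublinear_on S scale (\<lambda>x. INF q\<in>C. q x)"
proof -
  have bdd: "bdd_below ((\<lambda>q. q x) ` C)" if "x \<in> S" for x
  proof (rule bdd_belowI2)
    fix q assume "q \<in> C"
    then show "- p (- x) \<le> q x"
      using sublinear_neg[OF sub, of q x] le[of q "- x"] that by simp
  qed
  then show "x \<in> S \<Longrightarrow> bdd_below ((\<lambda>q. q x) ` C)" .
  show "sublinear_on S scale (\<lambda>x. INF q\<in>C. q x)"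
    unfolding sublinear_on_def
  proof (intro conjI ballI allI impI)
    fix x z assume x: "x \<in> S" and z: "z \<in> S"
    have *: "(INF q\<in>C. q (x + z)) \<le> q x + r z" if qr: "q \<in> C" "r \<in> C" for q r
    proof -
      obtain s where s: "s \<in> C" "s \<le> q" "s \<le> r" using chain[OF qr] qr by blast
      have "(INF q\<in>C. q (x + z)) \<le> s (x + z)"
        using s x z by (intro cINF_lower bdd) auto
      also have "\<dots> \<le> s x + s z" using s x z sub sublinear_add by blast
      also have "\<dots> \<le> q x + r z" using s by (simp add: add_mono le_funD)
      finally show ?thesis .
    qed
    have "(INF q\<in>C. q (x + z)) - q x \<le> (INF q\<in>C. q z)" if "q \<in> C" for q
      using C *[OF that] by (intro cINF_greatest) (auto simp: algebra_simps)
    then have "(INF q\<in>C. q (x + z)) - (INF q\<in>C. q z) \<le> (INF q\<in>C. q x)"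
      using C by (intro cINF_greatest) (auto simp: algebra_simps)
    then show "(INF q\<in>C. q (x + z)) \<le> (INF q\<in>C. q x) + (INF q\<in>C. q z)" by simp
  next
    fix s :: real and x assume s: "0 \<le> s" and x: "x \<in> S"
    show "(INF q\<in>C. q (scale s x)) \<le> s * (INF q\<in>C. q x)"
    proof (cases "s = 0")
      case True
      have "q 0 = 0" if "q \<in> C" for q using sub sublinear_0 that by blast
      then have "(\<lambda>q. q 0) ` C = {0}" using C by (auto simp: image_iff)
      then show ?thesis using True by simp
    next
      case False
      with s have s: "s > 0" by simp
      have "(INF q\<in>C. q (scale s x)) / s \<le> q x" if "q \<in> C" for q
      proof -
        have "(INF q\<in>C. q (scale s x)) \<le> q (scale s x)"
          using that x by (intro cINF_lower bdd) auto
        also have "\<dots> \<le> s * q x" using s x that sub sublinear_scale_le by (simp add: less_imp_le)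
        finally show ?thesis using s by (simp add: field_simps)
      qed
      then have "(INF q\<in>C. q (scale s x)) / s \<le> (INF q\<in>C. q x)"
        using C by (intro cINF_greatest) auto
      then show ?thesis using s by (simp add: field_simps)
    qed
  qed
qed

text \<open>A minimal sublinear functional \<open>q\<close> equals each of its directional modifications, which
  makes it superadditive.\<close>

lemma exists_linear_below_sublinear:
  assumes p: "sublinear_on S scale p"
  shows "\<exists>f. linear_map_on S scale (*) f \<and> (\<forall>x\<in>S. f x \<le> p x)"
proof -
  \<comment> \<open>Zorn's lemma compares functions on the whole type, so the values off
    \<open>S\<close> are fixed to 0; minimality then gives \<open>directional q y = q\<close> as an
    equality of functions.\<close>
  define A where "A = {q. sublinear_on S scale q \<and> (\<forall>x\<in>S. q x \<le> p x) \<and> (\<forall>x. x \<notin> S \<longrightarrow> q x = 0)}"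
  have "\<exists>m\<in>A. \<forall>a\<in>A. m \<ge> a \<longrightarrow> a = m"
  proof (rule predicate_Zorn)
    show "partial_order_on A (relation_of (\<ge>) A)"
      by (rule partial_order_on_relation_ofI) auto
    fix C assume C: "C \<in> Chains (relation_of (\<ge>) A)"
    then have CA: "C \<subseteq> A" and chain: "\<And>q r. q \<in> C \<Longrightarrow> r \<in> C \<Longrightarrow> q \<le> r \<or> r \<le> q"
      by (auto simp: Chains_def relation_of_def)
    show "\<exists>u\<in>A. \<forall>a\<in>C. a \<ge> u"
    proof (cases "C = {}")
      case True
      have "sublinear_on S scale (\<lambda>x. if x \<in> S then p x else 0)"
        using p by (simp add: sublinear_on_def)
      then show ?thesis using True
        by (intro bexI[of _ "\<lambda>x. if x \<in> S then p x else 0"]) (simp_all add: A_def)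
    next
      case False
      let ?u = "\<lambda>x. INF q\<in>C. q x"
      have sub: "sublinear_on S scale q" if "q \<in> C" for q using CA that by (auto simp: A_def)
      have le: "q x \<le> p x" if "q \<in> C" "x \<in> S" for q x using CA that by (auto simp: A_def)
      have bdd: "bdd_below ((\<lambda>q. q x) ` C)" if "x \<in> S" for x
        by (rule sublinear_INF_chain(1)[of C p, OF False]) (use sub chain le that in blast)+
      have u: "sublinear_on S scale ?u"
        by (rule sublinear_INF_chain(2)[of C p, OF False]) (use sub chain le in blast)+
      have zero: "q x = 0" if "q \<in> C" "x \<notin> S" for q x using CA that by (auto simp: A_def)
      have lower: "?u x \<le> q x" if q: "q \<in> C" for q x
      proof (cases "x \<in> S")
        case True
        then show ?thesis using bdd[of x] q by (auto intro!: cINF_lower)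
      next
        case outside: False
        then have "(\<lambda>q. q x) ` C = {0}" using zero q by (auto simp: image_iff)
        then show ?thesis using zero[OF q outside] by simp
      qed
      have "(\<lambda>q. q x) ` C = {0}" if "x \<notin> S" for x
        using zero that False by (auto simp: image_iff)
      then have "?u x = 0" if "x \<notin> S" for x using that by simp
      moreover have "?u x \<le> p x" if "x \<in> S" for x
        using lower le that False by (meson ex_in_conv order_trans)
      ultimately have "?u \<in> A"
        using u by (simp add: A_def)
      then show ?thesis using lower by (intro bexI[of _ ?u]) (auto simp: le_fun_def)
    qed
  qed
  then obtain q where qA: "q \<in> A" and min: "\<And>a. a \<in> A \<Longrightarrow> a \<le> q \<Longrightarrow> a = q" by blast
  then have q: "sublinear_on S scale q" and qp: "\<And>x. x \<in> S \<Longrightarrow> q x \<le> p x"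
    and q0: "\<And>x. x \<notin> S \<Longrightarrow> q x = 0"
    by (auto simp: A_def)
  have add: "q (x + y) = q x + q y" if x: "x \<in> S" and y: "y \<in> S" for x y
  proof -
    have below: "directional q y z \<le> q z" for z
      using directional_le[OF q y, of z 0] q0 by (cases "z \<in> S") (auto simp: directional_def)
    then have "directional q y z \<le> p z" if "z \<in> S" for z
      using qp[OF that] order_trans by blast
    moreover have "directional q y z = 0" if "z \<notin> S" for z
      using that by (simp add: directional_def)
    ultimately have "directional q y \<in> A"
      using sublinear_directional[OF q y] by (simp add: A_def)
    then have "directional q y = q" using min below by (simp add: le_fun_def)
    then have "q x \<le> q (x + y) - q y"
      using directional_le[OF q y x, of 1] by simp
    then show ?thesis using sublinear_add[OF q x y] by simp
  qed
  have neg: "q (- x) = - q x" if "x \<in> S" for x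
    using add[of x "- x"] sublinear_0[OF q] that by simp
  have "q (scale c x) = c * q x" if x: "x \<in> S" for c x
  proof (cases "0 \<le> c")
    case True
    then show ?thesis using sublinear_scale[OF q x] by simp
  next
    case False
    then have "q (scale (- c) x) = - c * q x" by (intro sublinear_scale[OF q x]) simp
    then show ?thesis using neg[of "scale c x"] x by simp
  qed
  then show ?thesis
    using add qp by (intro exI[of _ q]) (simp add: linear_map_on_def)
qed

text \<open>The linear functional is taken below \<open>directional p x0\<close> instead of
  \<open>p\<close>. Its value at \<open>- x0\<close> is then at most \<open>- p x0\<close>, which
  forces equality at \<open>x0\<close>.\<close>

theorem Hahn_Banach_sublinear:
  assumes p: "sublinear_on S scale p" and x0: "x0 \<in> S"
  shows "\<exists>f. linear_map_on S scale (*) f \<and> (\<forall>x\<in>S. f x \<le> p x) \<and> f x0 = p x0"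
proof -
  obtain f where f: "linear_map_on S scale (*) f" and le: "\<And>x. x \<in> S \<Longrightarrow> f x \<le> directional p x0 x"
    using exists_linear_below_sublinear[OF sublinear_directional[OF p x0]] by blast
  have fp: "f x \<le> p x" if "x \<in> S" for x
    using le[OF that] directional_le[OF p x0 that, of 0] by simp
  have "f (- x0) \<le> - p x0"
    using le[of "- x0"] directional_le[OF p x0, of "- x0" 1] x0 sublinear_0[OF p] by simp
  moreover have "f (- x0) = - f x0"
    using f x0 scale_minus_left[of 1 x0] scale_one[of x0] unfolding linear_map_on_def
    by (metis mult_minus_left mult_1)
  ultimately have "f x0 = p x0" using fp[OF x0] by simp
  then show ?thesis using f fp by blast
qed

text \<open>Gliding hump: from functionals \<open>f\<^sub>n \<le> p\<close> norming points \<open>a\<^sub>n\<close> with \<open>p a\<^sub>n \<ge> 4\<^sup>n\<close>, signs can be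
  chosen such that \<open>\<Sum>n. \<plusminus> 3\<^sup>-\<^sup>n f\<^sub>n\<close> is unbounded on the \<open>a\<^sub>n\<close>.\<close>

theorem weakly_bounded_imp_seminorm_bounded:
  assumes p: "sublinear_on S scale p" and sym: "\<And>x. x \<in> S \<Longrightarrow> p (- x) = p x"
    and A: "A \<subseteq> S"
    and weak: "\<And>f. linear_map_on S scale (*) f \<Longrightarrow> \<forall>x\<in>S. \<bar>f x\<bar> \<le> 3/2 * p x \<Longrightarrow>
      \<exists>C. \<forall>a\<in>A. \<bar>f a\<bar> \<le> C"
  shows "\<exists>C. \<forall>a\<in>A. p a \<le> C"
proof (rule ccontr)
  assume "\<nexists>C. \<forall>a\<in>A. p a \<le> C"
  then have "\<forall>n::nat. \<exists>a\<in>A. 4 ^ n < p a" by (meson not_le)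
  then obtain a where aA: "\<And>n. a n \<in> A" and a4: "\<And>n::nat. 4 ^ n < p (a n)" by metis
  have aS: "a n \<in> S" for n using aA A by blast
  have "\<exists>f. linear_map_on S scale (*) f \<and> (\<forall>x\<in>S. f x \<le> p x) \<and> f (a n) = p (a n)" for n
    using Hahn_Banach_sublinear[OF p aS] .
  then obtain f where lin: "\<And>n. linear_map_on S scale (*) (f n)"
    and fp: "\<And>n x. x \<in> S \<Longrightarrow> f n x \<le> p x" and fa: "\<And>n. f n (a n) = p (a n)"
    by metis
  have fneg: "f n (- x) = - f n x" if "x \<in> S" for n x
    using lin[of n] that scale_minus_left[of 1 x] scale_one[of x] unfolding linear_map_on_def
    by (metis mult_minus_left mult_1)
  have fabs: "\<bar>f n x\<bar> \<le> p x" if "x \<in> S" for n x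
    using fp[OF that, of n] fp[of "- x" n] fneg[OF that] sym[OF that] that by (simp add: abs_le_iff)
  have p0: "0 \<le> p x" if "x \<in> S" for x
    using fabs[OF that, of 0] by linarith
  \<comment> \<open>Of v + w and v - w, one has modulus at least |w|, so a sign that preserves the
    hump always exists. It depends on the partial sum \<open>u\<close> built so far, hence the
    recursion over functions in \<open>U\<close>.\<close>
  define step where "step n u = (if \<bar>p (a n) / 3 ^ n\<bar> \<le> \<bar>u (a n) + p (a n) / 3 ^ n\<bar> then 1 else - 1 :: real)"
    for n :: nat and u
  define U where "U = rec_nat (\<lambda>x. 0) (\<lambda>n u x. u x + step n u * (f n x / 3 ^ n))"
  define e where "e n = step n (U n)" for n
  have e1: "\<bar>e n\<bar> = 1" for n by (simp add: e_def step_def)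
  have U0: "U 0 x = 0" for x by (simp add: U_def)
  have US: "U (Suc n) x = U n x + e n * (f n x / 3 ^ n)" for n x by (simp add: U_def e_def)
  have Usum: "U n x = (\<Sum>i<n. e i * (f i x / 3 ^ i))" for n x
    by (induction n) (simp_all add: U0 US)
  have hump: "p (a n) / 3 ^ n \<le> \<bar>U (Suc n) (a n)\<bar>" for n
    unfolding US fa using p0[OF aS, of n] by (auto simp: e_def step_def)
  have bound: "\<bar>e i * (f i x / 3 ^ i)\<bar> \<le> p x * (1/3) ^ i" if "x \<in> S" for i x
    using fabs[OF that, of i] e1[of i]
    by (simp add: abs_mult power_one_over divide_right_mono)
  have geo: "summable (\<lambda>i. p x * (1/3) ^ i)" for x
    by (intro summable_mult summable_geometric) simp
  have summ: "summable (\<lambda>i. e i * (f i x / 3 ^ i))" if "x \<in> S" for x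
    by (rule summable_comparison_test'[OF geo[of x], of 0]) (use bound[OF that] in simp)
  define u where "u x = (\<Sum>i. e i * (f i x / 3 ^ i))" for x
  have u_lin: "linear_map_on S scale (*) u"
    unfolding linear_map_on_def
  proof (intro conjI ballI allI)
    fix x y assume x: "x \<in> S" and y: "y \<in> S"
    have "f i (x + y) = f i x + f i y" for i
      using lin[of i] x y by (simp add: linear_map_on_def)
    then show "u (x + y) = u x + u y"
      unfolding u_def suminf_add[OF summ[OF x] summ[OF y]]
      by (simp add: add_divide_distrib distrib_left)
  next
    fix c x assume x: "x \<in> S"
    have "f i (scale c x) = c * f i x" for i
      using lin[of i] x by (simp add: linear_map_on_def)
    then show "u (scale c x) = c * u x"
      unfolding u_def suminf_mult[OF summ[OF x], symmetric] by (simp add: mult.left_commute)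
  qed
  \<comment> \<open>The weights from index n on sum to (3/2) / 3^n; n = 0 is the domination by 3/2
    times \<open>p\<close> under which \<open>weak\<close> applies.\<close>
  have tail: "\<bar>u x - U n x\<bar> \<le> 3/2 * p x / 3 ^ n" if x: "x \<in> S" for n x
  proof -
    have "u x - U n x = (\<Sum>i. e (i + n) * (f (i + n) x / 3 ^ (i + n)))"
      using suminf_split_initial_segment[OF summ[OF x], of n] by (simp add: u_def Usum)
    also have "\<bar>\<dots>\<bar> \<le> (\<Sum>i. p x / 3 ^ n * (1/3) ^ i)"
    proof -
      have s: "summable (\<lambda>i. p x / 3 ^ n * (1/3::real) ^ i)"
        by (intro summable_mult summable_geometric) simp
      have b: "norm (e (i + n) * (f (i + n) x / 3 ^ (i + n))) \<le> p x / 3 ^ n * (1/3) ^ i" for i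
        using bound[OF x, of "i + n"] by (simp add: power_add power_one_over field_simps)
      show ?thesis using norm_suminf_le[OF b s] by simp
    qed
    also have "\<dots> = p x / 3 ^ n * (3/2)"
      by (subst suminf_mult) (auto intro!: summable_geometric simp: suminf_geometric)
    finally show ?thesis by (simp add: field_simps)
  qed
  have "\<forall>x\<in>S. \<bar>u x\<bar> \<le> 3/2 * p x"
    using tail[of _ 0] by (simp add: U0)
  with u_lin obtain C where C: "\<And>x. x \<in> A \<Longrightarrow> \<bar>u x\<bar> \<le> C"
    using weak[of u] by blast
  have "(4/3) ^ n / 2 \<le> C" for n
  proof -
    \<comment> \<open>After index n the tail has total weight (3/2) / 3^(n+1), which is half of
      3^-n: ratio 1/3 leaves half of the hump, and the choice of 4^n makes what is left grow like
      (4/3)^n.\<close>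
    have "p (a n) / 3 ^ n - p (a n) / 3 ^ n / 2 \<le> \<bar>u (a n)\<bar>"
      using hump[of n] tail[OF aS, of n "Suc n"] by simp
    moreover have "(4/3) ^ n \<le> p (a n) / 3 ^ n"
      using a4[of n] by (simp add: power_divide divide_right_mono)
    ultimately show ?thesis using C[OF aA, of n] by simp
  qed
  moreover obtain n where "2 * C < (4/3::real) ^ n"
    using real_arch_pow[of "4/3" "2 * C"] by auto
  ultimately show False by (metis field_sum_of_halves less_divide_eq_numeral1(1) mult.commute not_le)
qed

end

section \<open>Continuous seminorms\<close>

locale lcs = vector_space smul
  for smul :: "'k::real_or_complex \<Rightarrow> 'a::ab_group_add \<Rightarrow> 'a" +
  fixes X :: "'a topology"
  assumes lc: "lc_hausdorff_space smul X"
begin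

abbreviation S :: "'a set" where "S \<equiv> topspace X"

lemma subspace_S: "subspace S"
  using lc by (simp add: lc_hausdorff_space_def)

lemma S_closed [simp, intro]:
  "0 \<in> S" "x \<in> S \<Longrightarrow> y \<in> S \<Longrightarrow> x + y \<in> S" "x \<in> S \<Longrightarrow> smul c x \<in> S" "x \<in> S \<Longrightarrow> - x \<in> S"
  "x \<in> S \<Longrightarrow> y \<in> S \<Longrightarrow> x - y \<in> S"
  by (simp_all add: subspace_0 subspace_add subspace_scale subspace_neg subspace_diff subspace_S)

lemma S_sum: "(\<And>i. i \<in> I \<Longrightarrow> f i \<in> S) \<Longrightarrow> sum f I \<in> S"
  using subspace_sum[OF subspace_S] by blast

lemma continuous_map_plus:
  assumes "continuous_map Z X f" "continuous_map Z X g"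
  shows "continuous_map Z X (\<lambda>z. f z + g z)"
proof -
  have "continuous_map (prod_topology X X) X (\<lambda>(x, y). x + y)"
    using lc by (simp add: lc_hausdorff_space_def)
  with continuous_map_pairedI[OF assms] have "continuous_map Z X ((\<lambda>(x, y). x + y) \<circ> (\<lambda>z. (f z, g z)))"
    by (rule continuous_map_compose)
  then show ?thesis by (simp add: o_def)
qed

lemma continuous_map_smul:
  assumes "continuous_map Z euclidean h" "continuous_map Z X f"
  shows "continuous_map Z X (\<lambda>z. smul (h z) (f z))"
proof -
  have "continuous_map (prod_topology euclidean X) X (\<lambda>(c, x). smul c x)"
    using lc by (simp add: lc_hausdorff_space_def)
  with continuous_map_pairedI[OF assms]
  have "continuous_map Z X ((\<lambda>(c, x). smul c x) \<circ> (\<lambda>z. (h z, f z)))"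
    by (rule continuous_map_compose)
  then show ?thesis by (simp add: o_def)
qed

lemma openin_affine_preimage:
  assumes W: "openin X W" and y: "y \<in> S"
  shows "openin X {x \<in> S. smul c (x + y) \<in> W}"
proof -
  have "continuous_map X X (\<lambda>x. smul c (x + y))"
    by (intro continuous_map_smul continuous_map_plus) (use y in auto)
  then show ?thesis using W openin_continuous_map_preimage by blast
qed

text \<open>Continuity is encoded by the unit ball being a neighbourhood of 0, which suffices by
  homogeneity and subadditivity. Off \<open>S\<close> the function is arbitrary, so seminorm
  estimates carry membership in \<open>S\<close> along.\<close>

definition csn :: "('a \<Rightarrow> real) \<Rightarrow> bool"
  where "csn p \<longleftrightarrow> (\<forall>x\<in>S. 0 \<le> p x) \<and> (\<forall>x\<in>S. \<forall>y\<in>S. p (x + y) \<le> p x + p y) \<and>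
    (\<forall>c. \<forall>x\<in>S. p (smul c x) = norm c * p x) \<and> zero_nhd X {x \<in> S. p x \<le> 1}"

lemma csn_nonneg: "csn p \<Longrightarrow> x \<in> S \<Longrightarrow> 0 \<le> p x"
  and csn_add: "csn p \<Longrightarrow> x \<in> S \<Longrightarrow> y \<in> S \<Longrightarrow> p (x + y) \<le> p x + p y"
  and csn_scale: "csn p \<Longrightarrow> x \<in> S \<Longrightarrow> p (smul c x) = norm c * p x"
  and csn_nhd: "csn p \<Longrightarrow> zero_nhd X {x \<in> S. p x \<le> 1}"
  by (auto simp: csn_def)

lemma csn_0: "csn p \<Longrightarrow> p 0 = 0"
  using csn_scale[of p 0 0] by simp

lemma csn_neg: "csn p \<Longrightarrow> x \<in> S \<Longrightarrow> p (- x) = p x"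
  using csn_scale[of p x "- 1"] by simp

lemma csn_diff: "csn p \<Longrightarrow> x \<in> S \<Longrightarrow> y \<in> S \<Longrightarrow> p (x - y) \<le> p x + p y"
  using csn_add[of p x "- y"] by (simp add: csn_neg)

lemma csn_diff_commute: "csn p \<Longrightarrow> x \<in> S \<Longrightarrow> y \<in> S \<Longrightarrow> p (x - y) = p (y - x)"
  using csn_neg[of p "x - y"] by simp

lemma csn_triangle:
  "csn p \<Longrightarrow> x \<in> S \<Longrightarrow> y \<in> S \<Longrightarrow> z \<in> S \<Longrightarrow> p (x - z) \<le> p (x - y) + p (y - z)"
  using csn_add[of p "x - y" "y - z"] by simp

lemma csn_reverse_triangle: "csn p \<Longrightarrow> x \<in> S \<Longrightarrow> y \<in> S \<Longrightarrow> p x \<le> p (x - y) + p y"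
  using csn_add[of p "x - y" y] by simp

lemma openin_csn_ball:
  assumes p: "csn p" and a: "a \<in> S"
  shows "openin X {x \<in> S. p (x - a) < r}"
proof (subst openin_subopen, intro ballI)
  fix y assume y: "y \<in> {x \<in> S. p (x - a) < r}"
  \<comment> \<open>Half of the gap: the unit ball in \<open>csn\<close> yields a weak inequality
    only, and the other half makes the final inequality strict.\<close>
  define d where "d = (r - p (y - a)) / 2"
  have d: "d > 0" using y by (simp add: d_def)
  obtain U where U: "openin X U" "0 \<in> U" "U \<subseteq> {x \<in> S. p x \<le> 1}"
    using csn_nhd[OF p] by (auto simp: zero_nhd_def)
  let ?O = "{x \<in> S. smul (of_real (1 / d)) (x + - y) \<in> U}"
  have "openin X ?O" using y by (intro openin_affine_preimage U) auto
  moreover have "y \<in> ?O" using y U by simp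
  moreover have "?O \<subseteq> {x \<in> S. p (x - a) < r}"
  proof clarify
    fix x assume x: "x \<in> S" and "smul (of_real (1 / d)) (x + - y) \<in> U"
    then have "p (smul (of_real (1 / d)) (x - y)) \<le> 1" using U by auto
    then have "p (x - y) \<le> d"
      using d x y csn_scale[OF p, of "x - y" "of_real (1 / d)"]
      by (simp add: norm_divide)
    moreover have "p (x - a) \<le> p (x - y) + p (y - a)"
      using csn_triangle[OF p] x y a by simp
    ultimately show "p (x - a) < r" using d by (simp add: d_def field_simps)
  qed
  ultimately show "\<exists>T. openin X T \<and> y \<in> T \<and> T \<subseteq> {x \<in> S. p (x - a) < r}" by blast
qed

lemma openin_csn_ball_0: "csn p \<Longrightarrow> openin X {x \<in> S. p x < r}"
  using openin_csn_ball[of p 0 r] by simp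

lemma zero_nhdI_csn:
  assumes p: "csn p" and "0 < r" "{x \<in> S. p x < r} \<subseteq> V" "V \<subseteq> S"
  shows "zero_nhd X V"
  unfolding zero_nhd_def using openin_csn_ball_0[OF p, of r] assms csn_0[OF p] by auto

lemma csn_plus:
  assumes p: "csn p" and q: "csn q"
  shows "csn (\<lambda>x. p x + q x)"
proof -
  have "openin X ({x \<in> S. p x < 1/2} \<inter> {x \<in> S. q x < 1/2})"
    by (intro openin_Int openin_csn_ball_0 p q)
  moreover have "0 \<in> {x \<in> S. p x < 1/2} \<inter> {x \<in> S. q x < 1/2}"
    using csn_0[OF p] csn_0[OF q] by simp
  ultimately have "zero_nhd X {x \<in> S. p x + q x \<le> 1}"
    unfolding zero_nhd_def by force
  moreover have "p (x + y) + q (x + y) \<le> p x + q x + (p y + q y)" if "x \<in> S" "y \<in> S" for x y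
    using csn_add[OF p that] csn_add[OF q that] by simp
  ultimately show ?thesis
    using p q by (simp add: csn_def distrib_left)
qed

lemma csn_mult:
  assumes p: "csn p" and r: "0 < r"
  shows "csn (\<lambda>x. r * p x)"
proof -
  have "zero_nhd X {x \<in> S. r * p x \<le> 1}"
    using r by (intro zero_nhdI_csn[OF p, of "1 / r"]) (auto simp: field_simps)
  moreover have "r * p (x + y) \<le> r * p x + r * p y" if "x \<in> S" "y \<in> S" for x y
    using csn_add[OF p that] r by (metis distrib_left mult_left_mono less_imp_le)
  ultimately show ?thesis using p r by (simp add: csn_def mult.left_commute)
qed

text \<open>Scaling by \<open>1 / (q x + e)\<close> moves \<open>x\<close> into the open unit ball
  of \<open>q\<close>; adding \<open>e\<close> covers the case \<open>q x = 0\<close>.\<close>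

lemma csn_le_of_ball:
  assumes p: "csn p" and q: "csn q" and "{x \<in> S. q x < 1} \<subseteq> {x \<in> S. p x \<le> 1}" and x: "x \<in> S"
  shows "p x \<le> q x"
proof (rule field_le_epsilon)
  fix e :: real assume e: "0 < e"
  let ?t = "q x + e"
  have t: "?t > 0" using csn_nonneg[OF q x] e by simp
  then have n: "norm (of_real (1 / ?t) :: 'k) = 1 / ?t"
    by (metis abs_of_pos norm_of_real zero_less_divide_1_iff)
  have "q (smul (of_real (1 / ?t)) x) < 1"
    unfolding csn_scale[OF q x] n using t e by (simp add: field_simps)
  then have "p (smul (of_real (1 / ?t)) x) \<le> 1" using assms by blast
  then show "p x \<le> q x + e"
    unfolding csn_scale[OF p x] n using t by (simp add: field_simps)
qed

text \<open>The gauge of the largest balanced subset of a convex neighbourhood.\<close>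

lemma exists_csn_below_nhd:
  assumes V: "zero_nhd X V"
  shows "\<exists>p. csn p \<and> {x \<in> S. p x < 1} \<subseteq> V"
proof -
  obtain U0 where U0: "openin X U0" "0 \<in> U0" "U0 \<subseteq> V" using V by (auto simp: zero_nhd_def)
  have "neighbourhood_base_at 0 (scale_convex smul) X"
    using lc by (simp add: lc_hausdorff_space_def)
  then obtain U W where U: "openin X U" "0 \<in> U" "U \<subseteq> W" and W: "scale_convex smul W" "W \<subseteq> U0"
    using U0 unfolding neighbourhood_base_at_def by meson
  define D where "D = {x \<in> S. \<forall>c. norm c \<le> 1 \<longrightarrow> smul c x \<in> W}"
  have DV: "x \<in> V" if "x \<in> D" for x
  proof -
    have "smul 1 x \<in> W" using that unfolding D_def by (metis (mono_tags, lifting) mem_Collect_eq norm_one order_refl)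
    then show ?thesis using W U0 by auto
  qed
  have bal: "smul c x \<in> D" if "x \<in> D" "norm c \<le> 1" for c x
    using that unfolding D_def by (auto simp: norm_mult mult_le_one)
  have conv: "smul (of_real t) x + smul (of_real (1 - t)) y \<in> D"
    if "x \<in> D" "y \<in> D" "0 \<le> t" "t \<le> 1" for x y t
    unfolding D_def
  proof (intro CollectI conjI allI impI)
    show "smul (of_real t) x + smul (of_real (1 - t)) y \<in> S" using that by (auto simp: D_def)
    fix c :: 'k assume "norm c \<le> 1"
    then have "smul (of_real t) (smul c x) + smul (of_real (1 - t)) (smul c y) \<in> W"
      using that W(1) unfolding D_def scale_convex_def by blast
    then show "smul c (smul (of_real t) x + smul (of_real (1 - t)) y) \<in> W"
      by (simp only: scale_right_distrib scale_scale mult.commute)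
  qed
  \<comment> \<open>That \<open>D\<close> is a neighbourhood of 0 comes from joint continuity at (0,
    0): some disc of scalars times some neighbourhood of 0 lands in \<open>U\<close>. The dilation
    by 2/d in \<open>?B\<close> below trades the radius d of the disc for all scalars of norm at
    most 1.\<close>
  have "continuous_map (prod_topology euclidean X) X (\<lambda>(c, x). smul c x)"
    using lc by (simp add: lc_hausdorff_space_def)
  then have Z: "openin (prod_topology euclidean X)
      {z \<in> topspace (prod_topology euclidean X). (\<lambda>(c, x). smul c x) z \<in> U}"
    using U(1) openin_continuous_map_preimage by blast
  have Z0: "(0, 0) \<in> {z \<in> topspace (prod_topology euclidean X). (\<lambda>(c, x). smul c x) z \<in> U}"
    using U(2) by simp
  have "\<exists>A B. openin euclidean A \<and> openin X B \<and> 0 \<in> A \<and> 0 \<in> B \<and>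
      A \<times> B \<subseteq> {z \<in> topspace (prod_topology euclidean X). (\<lambda>(c, x). smul c x) z \<in> U}"
    by (rule openin_prod_topology_alt[THEN iffD1, OF Z, rule_format, OF Z0])
  then obtain A B where "openin euclidean A" and A0: "0 \<in> A" and B: "openin X B" "0 \<in> B"
    and AB: "A \<times> B \<subseteq> {z \<in> topspace (prod_topology euclidean X). (\<lambda>(c, x). smul c x) z \<in> U}"
    by (elim exE conjE) (rule that; assumption)
  then have A: "open A" "0 \<in> A" by simp_all
  obtain d where d: "d > 0" "ball 0 d \<subseteq> A" using A open_contains_ball by blast
  let ?B = "{x \<in> S. smul (of_real (2 / d)) (x + 0) \<in> B}"
  have oB: "openin X ?B" by (intro openin_affine_preimage B) simp
  have "?B \<subseteq> D"
    unfolding D_def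
  proof clarify
    fix x and c :: 'k assume x: "x \<in> S" "smul (of_real (2 / d)) (x + 0) \<in> B" and c: "norm c \<le> 1"
    have "norm (c * of_real (d / 2)) < d"
      using c d by (simp add: norm_mult)
    then have "c * of_real (d / 2) \<in> A" using d by auto
    then have "smul (c * of_real (d / 2)) (smul (of_real (2 / d)) x) \<in> U" using AB x by auto
    moreover have "(c * of_real (d / 2)) * of_real (2 / d) = c" using d by simp
    ultimately have "smul c x \<in> U" by (metis scale_scale)
    then show "smul c x \<in> W" using U by blast
  qed
  then have nhd: "zero_nhd X D"
    unfolding zero_nhd_def using oB B by (intro conjI exI[of _ ?B]) (auto simp: D_def)
  define G where "G x = {t. 0 < t \<and> smul (of_real (1 / t)) x \<in> D}" for x
  define p where "p x = Inf (G x)" for x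
  have Gbdd: "bdd_below (G x)" for x by (rule bdd_belowI[of _ 0]) (simp add: G_def)
  have Gne: "G x \<noteq> {}" if x: "x \<in> S" for x
  proof -
    have "continuous_map euclidean X (\<lambda>c. smul c x)"
      by (intro continuous_map_smul) (use x in auto)
    then have "open {c. smul c x \<in> ?B}"
      using openin_continuous_map_preimage[OF _ oB, of euclidean "\<lambda>c. smul c x"] by simp
    moreover have "0 \<in> {c. smul c x \<in> ?B}" using B by simp
    ultimately obtain e where e: "e > 0" "ball 0 e \<subseteq> {c. smul c x \<in> ?B}"
      using open_contains_ball by blast
    have "of_real (e / 2) \<in> ball (0::'k) e" using e by simp
    then have "smul (of_real (e / 2)) x \<in> D" using e \<open>?B \<subseteq> D\<close> by blast
    then have "2 / e \<in> G x" using e by (simp add: G_def)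
    then show ?thesis by blast
  qed
  have pG: "p x \<le> t" if "t \<in> G x" for x t
    unfolding p_def using that Gbdd by (rule cInf_lower)
  have Gp: "c \<le> p x" if "x \<in> S" "\<And>t. t \<in> G x \<Longrightarrow> c \<le> t" for c x
    unfolding p_def using Gne that by (intro cInf_greatest) auto
  have nonneg: "0 \<le> p x" if "x \<in> S" for x
    by (rule Gp[OF that]) (simp add: G_def)
  have add: "p (x + y) \<le> p x + p y" if xy: "x \<in> S" "y \<in> S" for x y
  proof -
    have *: "s + t \<in> G (x + y)" if s: "s \<in> G x" and t: "t \<in> G y" for s t
    proof -
      have st: "s > 0" "t > 0" using s t by (auto simp: G_def)
      \<comment> \<open>The point (x + y) / (s + t) is the convex combination of x / s and y / t
        with weights s / (s + t) and t / (s + t).\<close>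
      have "smul (of_real (s / (s + t))) (smul (of_real (1 / s)) x)
        + smul (of_real (1 - s / (s + t))) (smul (of_real (1 / t)) y) \<in> D"
        using s t st by (intro conv) (auto simp: G_def)
      moreover have "of_real (s / (s + t)) * of_real (1 / s) = (of_real (1 / (s + t)) :: 'k)"
        using st unfolding of_real_mult[symmetric] by simp
      moreover have "of_real (1 - s / (s + t)) * of_real (1 / t) = (of_real (1 / (s + t)) :: 'k)"
        using st unfolding of_real_mult[symmetric] by (simp add: field_simps)
      ultimately have "smul (of_real (1 / (s + t))) (x + y) \<in> D"
        by (simp only: scale_scale scale_right_distrib)
      then show ?thesis using st by (simp add: G_def)
    qed
    have "p (x + y) - s \<le> p y" if "s \<in> G x" for s
      using pG[OF *[OF that]] by (intro Gp) (use xy in \<open>auto simp: algebra_simps\<close>)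
    then have "p (x + y) - p y \<le> p x"
      by (intro Gp) (use xy in \<open>auto simp: algebra_simps\<close>)
    then show ?thesis by simp
  qed
  have scale_le: "p (smul c x) \<le> norm c * p x" if x: "x \<in> S" and c: "c \<noteq> 0" for c x
  proof -
    have "norm c * t \<in> G (smul c x)" if t: "t \<in> G x" for t
    proof -
      \<comment> \<open>Balancedness absorbs the phase c / |c|, so only the factor |c| has to be
        moved into the gauge parameter.\<close>
      have "smul (c / of_real (norm c)) (smul (of_real (1 / t)) x) \<in> D"
        by (rule bal) (use t c in \<open>auto simp: G_def norm_divide\<close>)
      moreover have "c / of_real (norm c) * of_real (1 / t) = of_real (1 / (norm c * t)) * c"
        by simp
      ultimately show ?thesis using c t by (simp add: G_def)
    qed
    then have "p (smul c x) / norm c \<le> p x"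
      using pG c by (intro Gp[OF x]) (simp add: field_simps)
    then show ?thesis using c by (simp add: field_simps)
  qed
  have scale: "p (smul c x) = norm c * p x" if x: "x \<in> S" for c x
  proof (cases "c = 0")
    case True
    have "0 \<in> D" using U by (auto simp: D_def)
    then have "p 0 \<le> t" if "t > 0" for t using that by (intro pG) (simp add: G_def)
    then have "p 0 \<le> 0" by (meson dense not_le)
    then show ?thesis using True nonneg[of 0] by simp
  next
    case False
    have "p x = p (smul (inverse c) (smul c x))" using False by simp
    also have "\<dots> \<le> norm (inverse c) * p (smul c x)"
      using x False by (intro scale_le) auto
    finally have "norm c * p x \<le> p (smul c x)"
      using False by (simp add: norm_inverse norm_divide field_simps)
    then show ?thesis using scale_le[OF x False] by simp
  qed
  have "D \<subseteq> {x \<in> S. p x \<le> 1}"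
    using pG[of 1] by (auto simp: G_def D_def)
  then have "zero_nhd X {x \<in> S. p x \<le> 1}" using nhd by (auto simp: zero_nhd_def)
  then have "csn p" using nonneg add scale by (simp add: csn_def)
  moreover have "x \<in> V" if x: "x \<in> S" and "p x < 1" for x
  proof -
    obtain t where t: "t \<in> G x" "t < 1"
      using \<open>p x < 1\<close> Gp[OF x, of 1] by (meson not_le)
    then have "smul (of_real t) (smul (of_real (1 / t)) x) \<in> D"
      by (intro bal[of "smul (of_real (1 / t)) x"]) (auto simp: G_def)
    then show ?thesis using t DV by (auto simp: G_def)
  qed
  ultimately show ?thesis by blast
qed

text \<open>A single seminorm with radius 1 suffices at each point, because the gauge of a
  neighbourhood of 0 already has its open unit ball inside that neighbourhood.\<close>

lemma openin_iff_csn: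
  "openin X W \<longleftrightarrow> W \<subseteq> S \<and> (\<forall>a\<in>W. \<exists>p. csn p \<and> {x \<in> S. p (x - a) < 1} \<subseteq> W)"
proof (intro iffI conjI ballI)
  assume W: "openin X W"
  then show "W \<subseteq> S" by (rule openin_subset)
  fix a assume a: "a \<in> W"
  have aS: "a \<in> S" using a \<open>W \<subseteq> S\<close> by blast
  have "openin X {x \<in> S. smul 1 (x + a) \<in> W}" by (intro openin_affine_preimage W aS)
  then have "zero_nhd X {x \<in> S. smul 1 (x + a) \<in> W}"
    unfolding zero_nhd_def using a by auto
  then obtain p where p: "csn p" "{x \<in> S. p x < 1} \<subseteq> {x \<in> S. smul 1 (x + a) \<in> W}"
    using exists_csn_below_nhd by blast
  have "{x \<in> S. p (x - a) < 1} \<subseteq> W"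
  proof clarify
    fix x assume "x \<in> S" "p (x - a) < 1"
    then have "x - a \<in> {x \<in> S. p x < 1}" using aS by simp
    then show "x \<in> W" using p(2) by fastforce
  qed
  then show "\<exists>p. csn p \<and> {x \<in> S. p (x - a) < 1} \<subseteq> W" using p by blast
next
  assume W: "W \<subseteq> S \<and> (\<forall>a\<in>W. \<exists>p. csn p \<and> {x \<in> S. p (x - a) < 1} \<subseteq> W)"
  show "openin X W"
  proof (subst openin_subopen, intro ballI)
    fix a assume a: "a \<in> W"
    obtain p where p: "csn p" "{x \<in> S. p (x - a) < 1} \<subseteq> W"
      using bspec[OF conjunct2[OF W] a] by auto
    have aS: "a \<in> S" using W a by auto
    have "a \<in> {x \<in> S. p (x - a) < 1}" using aS csn_0[OF p(1)] by simp
    then show "\<exists>T. openin X T \<and> a \<in> T \<and> T \<subseteq> W"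
      using openin_csn_ball[OF p(1) aS] p(2) by metis
  qed
qed

lemma csn_separates:
  assumes "x \<in> S" "\<And>p. csn p \<Longrightarrow> p x = 0"
  shows "x = 0"
proof (rule ccontr)
  assume "x \<noteq> 0"
  moreover have "Hausdorff_space X" using lc by (simp add: lc_hausdorff_space_def)
  ultimately obtain U V where U: "openin X U" "0 \<in> U" and V: "x \<in> V" "disjnt U V"
    unfolding Hausdorff_space_def using assms(1) S_closed(1) by metis
  then have "zero_nhd X U" by (auto simp: zero_nhd_def dest: openin_subset)
  then obtain p where "csn p" "{x \<in> S. p x < 1} \<subseteq> U" using exists_csn_below_nhd by blast
  then have "x \<in> U" using assms by force
  then show False using V by (simp add: disjnt_iff)
qed

lemma limitin_iff_csn:
  assumes "\<And>n. f n \<in> S"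
  shows "limitin X f l F \<longleftrightarrow> l \<in> S \<and> (\<forall>p. csn p \<longrightarrow> ((\<lambda>n. p (f n - l)) \<longlongrightarrow> 0) F)"
proof (intro iffI conjI allI impI)
  assume L: "limitin X f l F"
  then show l: "l \<in> S" by (simp add: limitin_def)
  fix p assume p: "csn p"
  show "((\<lambda>n. p (f n - l)) \<longlongrightarrow> 0) F"
  proof (rule tendstoI)
    fix e :: real assume "0 < e"
    have "openin X {x \<in> S. p (x - l) < e}" using p l by (rule openin_csn_ball)
    moreover have "l \<in> {x \<in> S. p (x - l) < e}" using l csn_0[OF p] \<open>0 < e\<close> by simp
    ultimately have "\<forall>\<^sub>F n in F. f n \<in> {x \<in> S. p (x - l) < e}"
      using L unfolding limitin_def by blast
    then show "\<forall>\<^sub>F n in F. dist (p (f n - l)) 0 < e"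
      by eventually_elim (use l csn_nonneg[OF p] in \<open>simp add: dist_real_def\<close>)
  qed
next
  assume R: "l \<in> S \<and> (\<forall>p. csn p \<longrightarrow> ((\<lambda>n. p (f n - l)) \<longlongrightarrow> 0) F)"
  show "limitin X f l F"
    unfolding limitin_def
  proof (intro conjI allI impI)
    show "l \<in> S" using R by blast
    fix U assume "openin X U \<and> l \<in> U"
    then obtain p where p: "csn p" "{x \<in> S. p (x - l) < 1} \<subseteq> U"
      unfolding openin_iff_csn by blast
    have "\<forall>\<^sub>F n in F. p (f n - l) < 1"
      using R p order_tendstoD(2)[of "\<lambda>n. p (f n - l)" 0 F 1] by simp
    then show "\<forall>\<^sub>F n in F. f n \<in> U"
      by eventually_elim (use p assms in auto)
  qed
qed

lemma vn_bounded_iff_csn: "vn_bounded smul X B \<longleftrightarrow> B \<subseteq> S \<and> (\<forall>p. csn p \<longrightarrow> (\<exists>C. \<forall>x\<in>B. p x \<le> C))"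
proof (intro iffI conjI allI impI)
  assume B: "vn_bounded smul X B"
  then show BS: "B \<subseteq> S" by (simp add: vn_bounded_def)
  fix p assume p: "csn p"
  then obtain r where r: "r > 0" "\<And>c. r \<le> norm c \<Longrightarrow> B \<subseteq> smul c ` {x \<in> S. p x \<le> 1}"
    using B csn_nhd[OF p] unfolding vn_bounded_def absorbs_def by meson
  have "p x \<le> r" if "x \<in> B" for x
  proof -
    obtain y where "y \<in> S" "p y \<le> 1" "x = smul (of_real r) y"
      using r(2)[of "of_real r"] r(1) \<open>x \<in> B\<close> by auto
    then show ?thesis using csn_scale[OF p, of y "of_real r"] r by simp
  qed
  then show "\<exists>C. \<forall>x\<in>B. p x \<le> C" by blast
next
  assume R: "B \<subseteq> S \<and> (\<forall>p. csn p \<longrightarrow> (\<exists>C. \<forall>x\<in>B. p x \<le> C))"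
  show "vn_bounded smul X B"
    unfolding vn_bounded_def absorbs_def
  proof (intro conjI allI impI)
    show "B \<subseteq> S" using R by blast
    fix V assume "zero_nhd X V"
    then obtain p where p: "csn p" "{x \<in> S. p x < 1} \<subseteq> V" using exists_csn_below_nhd by blast
    then obtain C where C: "\<And>x. x \<in> B \<Longrightarrow> p x \<le> C" using R by blast
    have "x \<in> smul c ` V" if c: "\<bar>C\<bar> + 1 \<le> norm c" and x: "x \<in> B" for c x
    proof -
      have c0: "c \<noteq> 0" "norm c > 0" using c by auto
      have "p (smul (inverse c) x) = p x / norm c"
        using csn_scale[OF p(1), of x "inverse c"] R x
        by (auto simp: norm_inverse divide_inverse mult.commute)
      also have "\<dots> < 1" using C[OF x] c c0 by simp
      finally have "smul (inverse c) x \<in> V" using p(2) R x by blast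
      then show ?thesis using c0 by (intro image_eqI[of _ _ "smul (inverse c) x"]) auto
    qed
    then show "\<exists>r>0. \<forall>c. r \<le> norm c \<longrightarrow> B \<subseteq> smul c ` V"
      by (intro exI[of _ "\<bar>C\<bar> + 1"]) auto
  qed
qed

lemma vn_bounded_csn: "vn_bounded smul X B \<Longrightarrow> csn p \<Longrightarrow> \<exists>C. \<forall>x\<in>B. p x \<le> C"
  by (simp add: vn_bounded_iff_csn)

section \<open>Operators and functionals\<close>

abbreviation operators :: "('a \<Rightarrow> 'a) set" where "operators \<equiv> continuous_operators smul X"

lemma operator_closed: "T \<in> operators \<Longrightarrow> x \<in> S \<Longrightarrow> T x \<in> S"
  unfolding continuous_operators_def using continuous_map_image_subset_topspace by blast

lemma operator_add: "T \<in> operators \<Longrightarrow> x \<in> S \<Longrightarrow> y \<in> S \<Longrightarrow> T (x + y) = T x + T y"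
  and operator_scale: "T \<in> operators \<Longrightarrow> x \<in> S \<Longrightarrow> T (smul c x) = smul c (T x)"
  by (auto simp: continuous_operators_def linear_map_on_def)

lemma operator_0: "T \<in> operators \<Longrightarrow> T 0 = 0"
  using operator_scale[of T 0 0] by simp

lemma operator_diff: "T \<in> operators \<Longrightarrow> x \<in> S \<Longrightarrow> y \<in> S \<Longrightarrow> T (x - y) = T x - T y"
  using operator_add[of T "x - y" y] by simp

lemma csn_operator:
  assumes T: "T \<in> operators" and p: "csn p"
  shows "csn (\<lambda>x. p (T x))"
proof -
  have "openin X {x \<in> S. T x \<in> {x \<in> S. p x < 1}}"
    using T openin_continuous_map_preimage openin_csn_ball_0[OF p]
    unfolding continuous_operators_def by blast
  then have "zero_nhd X {x \<in> S. p (T x) \<le> 1}"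
    unfolding zero_nhd_def using operator_0[OF T] csn_0[OF p]
    by (intro conjI exI[of _ "{x \<in> S. T x \<in> {x \<in> S. p x < 1}}"]) auto
  then show ?thesis
    using p operator_closed[OF T] operator_add[OF T] operator_scale[OF T] by (simp add: csn_def)
qed

text \<open>Meant for the pointwise limit of the means: domination by a continuous seminorm is what
  passes to the limit.\<close>

lemma operatorI:
  assumes lin: "linear_map_on S smul smul T" and closed: "\<And>x. x \<in> S \<Longrightarrow> T x \<in> S"
    and bound: "\<And>p. csn p \<Longrightarrow> \<exists>q. csn q \<and> (\<forall>x\<in>S. p (T x) \<le> q x)"
  shows "T \<in> operators"
proof -
  have Tdiff: "T (x - y) = T x - T y" if "x \<in> S" "y \<in> S" for x y
    using lin that unfolding linear_map_on_def
    by (metis S_closed(5) add_diff_cancel_right' diff_add_cancel)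
  have "continuous_map X X T"
    unfolding continuous_map_def
  proof (intro conjI allI impI)
    show "T \<in> S \<rightarrow> S" using closed by blast
    fix W assume W: "openin X W"
    show "openin X {x \<in> S. T x \<in> W}"
      unfolding openin_iff_csn
    proof (intro conjI ballI)
      fix a assume a: "a \<in> {x \<in> S. T x \<in> W}"
      then obtain p where p: "csn p" "{x \<in> S. p (x - T a) < 1} \<subseteq> W"
        using W unfolding openin_iff_csn by blast
      then obtain q where q: "csn q" "\<And>x. x \<in> S \<Longrightarrow> p (T x) \<le> q x" using bound[OF p(1)] by auto
      have "{x \<in> S. q (x - a) < 1} \<subseteq> {x \<in> S. T x \<in> W}"
      proof clarify
        fix x assume x: "x \<in> S" "q (x - a) < 1"
        then have "p (T x - T a) < 1" using q(2)[of "x - a"] a Tdiff[of x a] by simp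
        then show "T x \<in> W" using p(2) closed[OF x(1)] by auto
      qed
      then show "\<exists>p. csn p \<and> {x \<in> S. p (x - a) < 1} \<subseteq> {x \<in> S. T x \<in> W}" using q by blast
    qed auto
  qed
  then show ?thesis using lin by (simp add: continuous_operators_def)
qed

lemma equicontinuous_iff_csn:
  "equicontinuous_operators smul X H \<longleftrightarrow>
    H \<subseteq> operators \<and> (\<forall>p. csn p \<longrightarrow> (\<exists>q. csn q \<and> (\<forall>T\<in>H. \<forall>x\<in>S. p (T x) \<le> q x)))"
proof (intro iffI conjI allI impI)
  assume H: "equicontinuous_operators smul X H"
  then show HL: "H \<subseteq> operators" by (simp add: equicontinuous_operators_def)
  fix p assume p: "csn p"
  obtain U where U: "zero_nhd X U" "\<And>T. T \<in> H \<Longrightarrow> T ` U \<subseteq> {x \<in> S. p x \<le> 1}"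
    using H csn_nhd[OF p] unfolding equicontinuous_operators_def by meson
  obtain q where q: "csn q" "{x \<in> S. q x < 1} \<subseteq> U" using exists_csn_below_nhd[OF U(1)] by blast
  have "p (T x) \<le> q x" if T: "T \<in> H" and x: "x \<in> S" for T x
  proof (rule csn_le_of_ball[OF csn_operator[OF _ p] q(1) _ x])
    show "T \<in> operators" using HL T by blast
    show "{x \<in> S. q x < 1} \<subseteq> {x \<in> S. p (T x) \<le> 1}" using q(2) U(2)[OF T] by blast
  qed
  then show "\<exists>q. csn q \<and> (\<forall>T\<in>H. \<forall>x\<in>S. p (T x) \<le> q x)" using q by blast
next
  assume R: "H \<subseteq> operators \<and> (\<forall>p. csn p \<longrightarrow> (\<exists>q. csn q \<and> (\<forall>T\<in>H. \<forall>x\<in>S. p (T x) \<le> q x)))"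
  show "equicontinuous_operators smul X H"
    unfolding equicontinuous_operators_def
  proof (intro conjI allI impI)
    show HL: "H \<subseteq> operators" using R by blast
    fix V assume "zero_nhd X V"
    then obtain p where p: "csn p" "{x \<in> S. p x < 1} \<subseteq> V" using exists_csn_below_nhd by blast
    then have "\<exists>q. csn q \<and> (\<forall>T\<in>H. \<forall>x\<in>S. p (T x) \<le> q x)" using R by auto
    then obtain q where q: "csn q" "\<And>T x. T \<in> H \<Longrightarrow> x \<in> S \<Longrightarrow> p (T x) \<le> q x" by auto
    have "T ` {x \<in> S. q x < 1} \<subseteq> V" if T: "T \<in> H" for T
    proof clarify
      fix x assume x: "x \<in> S" "q x < 1"
      have "T x \<in> S" using operator_closed[OF _ x(1)] HL T by auto
      moreover have "p (T x) < 1" using q(2)[OF T x(1)] x(2) by simp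
      ultimately show "T x \<in> V" using p(2) by auto
    qed
    then show "\<exists>U. zero_nhd X U \<and> (\<forall>T\<in>H. T ` U \<subseteq> V)"
      using openin_csn_ball_0[OF q(1), of 1] csn_0[OF q(1)]
      by (intro exI[of _ "{x \<in> S. q x < 1}"]) (auto simp: zero_nhd_def)
  qed
qed

section \<open>Continuous linear functionals\<close>

abbreviation E' :: "('a \<Rightarrow> 'k) set" where "E' \<equiv> dual_space smul X"

lemma functional_add: "u \<in> E' \<Longrightarrow> x \<in> S \<Longrightarrow> y \<in> S \<Longrightarrow> u (x + y) = u x + u y"
  and functional_scale: "u \<in> E' \<Longrightarrow> x \<in> S \<Longrightarrow> u (smul c x) = c * u x"
  and functional_outside: "u \<in> E' \<Longrightarrow> x \<notin> S \<Longrightarrow> u x = 0"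
  by (auto simp: dual_space_def linear_map_on_def)

lemma functional_0: "u \<in> E' \<Longrightarrow> u 0 = 0"
  using functional_scale[of u 0 0] by simp

lemma functional_diff: "u \<in> E' \<Longrightarrow> x \<in> S \<Longrightarrow> y \<in> S \<Longrightarrow> u (x - y) = u x - u y"
  using functional_add[of u "x - y" y] by simp

lemma functional_sum: "u \<in> E' \<Longrightarrow> (\<And>i. i \<in> I \<Longrightarrow> f i \<in> S) \<Longrightarrow> u (sum f I) = (\<Sum>i\<in>I. u (f i))"
  by (induction I rule: infinite_finite_induct) (simp_all add: functional_0 functional_add S_sum)

lemma csn_functional:
  assumes u: "u \<in> E'"
  shows "csn (\<lambda>x. norm (u x))"
proof -
  have "openin X {x \<in> S. u x \<in> ball 0 1}"
    using u openin_continuous_map_preimage[of X euclidean u "ball 0 1"] by (simp add: dual_space_def)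
  then have "zero_nhd X {x \<in> S. norm (u x) \<le> 1}"
    unfolding zero_nhd_def using functional_0[OF u]
    by (intro conjI exI[of _ "{x \<in> S. u x \<in> ball 0 1}"]) auto
  then show ?thesis
    using functional_add[OF u] functional_scale[OF u]
    by (simp add: csn_def norm_triangle_ineq norm_mult)
qed

lemma functionalI:
  assumes lin: "linear_map_on S smul (*) u" and out: "\<And>x. x \<notin> S \<Longrightarrow> u x = 0"
    and q: "csn q" "\<And>x. x \<in> S \<Longrightarrow> norm (u x) \<le> q x"
  shows "u \<in> E'"
proof -
  have udiff: "u (x - y) = u x - u y" if "x \<in> S" "y \<in> S" for x y
    using lin that unfolding linear_map_on_def
    by (metis S_closed(5) add_diff_cancel_right' diff_add_cancel)
  have "continuous_map X euclidean u"
    unfolding continuous_map_def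
  proof (intro conjI allI impI)
    fix W :: "'k set" assume "openin euclidean W"
    then have W: "open W" by simp
    show "openin X {x \<in> S. u x \<in> W}"
      unfolding openin_iff_csn
    proof (intro conjI ballI)
      fix a assume a: "a \<in> {x \<in> S. u x \<in> W}"
      then obtain e where e: "e > 0" "ball (u a) e \<subseteq> W" using W open_contains_ball by blast
      have "{x \<in> S. 1 / e * q (x - a) < 1} \<subseteq> {x \<in> S. u x \<in> W}"
      proof clarify
        fix x assume x: "x \<in> S" "1 / e * q (x - a) < 1"
        have "norm (u x - u a) = norm (u (x - a))" using udiff[of x a] x a by simp
        also have "\<dots> \<le> q (x - a)" using q(2)[of "x - a"] x a by simp
        also have "\<dots> < e" using x e by (simp add: field_simps)
        finally have "norm (u x - u a) < e" .
        then show "u x \<in> W" using e by (auto simp: dist_norm norm_minus_commute)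
      qed
      then show "\<exists>p. csn p \<and> {x \<in> S. p (x - a) < 1} \<subseteq> {x \<in> S. u x \<in> W}"
        using csn_mult[OF q(1), of "1 / e"] e by (intro exI[of _ "\<lambda>x. 1 / e * q x"]) simp
    qed auto
  qed simp
  then show ?thesis using lin out by (simp add: dual_space_def)
qed

text \<open>A real functional \<open>f\<close> is the real part of \<open>f x - j f (j x)\<close>.\<close>

lemma real_functional_dominated:
  assumes lin: "linear_map_on S (\<lambda>t. smul (of_real t)) (*) f"
    and q: "csn q" "\<And>x. x \<in> S \<Longrightarrow> \<bar>f x\<bar> \<le> q x"
  shows "\<exists>u\<in>E'. \<forall>x\<in>S. \<bar>f x\<bar> \<le> norm (u x)"
proof -
  have add: "f (x + y) = f x + f y" if "x \<in> S" "y \<in> S" for x y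
    using lin that by (simp add: linear_map_on_def)
  have scl: "f (smul (of_real t) x) = t * f x" if "x \<in> S" for t x
    using lin that by (simp add: linear_map_on_def)
  consider (real) "\<forall>x::'k. \<exists>a. x = a *\<^sub>R 1"
    | (complex) j :: 'k where "j * j = - 1" "\<forall>x. \<exists>a b. x = a *\<^sub>R 1 + b *\<^sub>R j"
    using real_or_complex[where 'a = 'k] by blast
  then show ?thesis
  proof cases
    case real
    define u :: "'a \<Rightarrow> 'k" where "u x = (if x \<in> S then of_real (f x) else 0)" for x
    have "u (smul c x) = c * u x" if x: "x \<in> S" for c x
    proof -
      obtain a where "c = of_real a" using real by (metis of_real_def)
      then show ?thesis using x scl[OF x, of a] by (simp add: u_def)
    qed
    then have "linear_map_on S smul (*) u"
      by (simp add: linear_map_on_def u_def add)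
    then have "u \<in> E'"
      by (rule functionalI[OF _ _ q(1)]) (use q(2) in \<open>auto simp: u_def\<close>)
    then show ?thesis by (intro bexI[of _ u]) (auto simp: u_def)
  next
    case complex
    define u :: "'a \<Rightarrow> 'k"
      where "u x = (if x \<in> S then of_real (f x) - j * of_real (f (smul j x)) else 0)" for x
    have u: "u x = of_real (f x) - j * of_real (f (smul j x))" if "x \<in> S" for x
      using that by (simp add: u_def)
    have uadd: "u (x + y) = u x + u y" if "x \<in> S" "y \<in> S" for x y
      using that by (simp add: u add scale_right_distrib algebra_simps)
    have "u (smul c x) = c * u x" if x: "x \<in> S" for c x
    proof -
      obtain a b where c: "c = of_real a + of_real b * j"
        using complex(2)[rule_format, of c] by (auto simp: scaleR_conv_of_real)
      have ureal: "u (smul (of_real t) z) = of_real t * u z" if z: "z \<in> S" for t z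
      proof -
        have "smul j (smul (of_real t) z) = smul (of_real t) (smul j z)"
          by (simp add: mult.commute)
        then show ?thesis using z by (simp only: u S_closed scl) (simp add: algebra_simps)
      qed
      have "f (- x) = - f x" using scl[OF x, of "- 1"] by simp
      moreover have "smul j (smul j x) = - x" using complex(1) by simp
      ultimately have uj: "u (smul j x) = j * u x"
        using complex(1) x by (simp add: u algebra_simps flip: mult.assoc)
      have "u (smul c x) = u (smul (of_real a) x + smul (of_real b) (smul j x))"
        by (simp add: c scale_left_distrib)
      also have "\<dots> = of_real a * u x + of_real b * (j * u x)"
        using x by (simp only: uadd S_closed ureal uj)
      finally show ?thesis by (simp add: c distrib_right)
    qed
    then have lin_u: "linear_map_on S smul (*) u"
      using uadd by (simp add: linear_map_on_def)
    have nj: "norm j * norm j = 1" using complex(1) by (metis norm_mult norm_minus_cancel norm_one)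
    then have nj: "norm j = 1" by (metis abs_norm_cancel abs_square_eq_1 power2_eq_square)
    have "norm (u x) \<le> 2 * q x" if x: "x \<in> S" for x
    proof -
      have "norm (u x) \<le> \<bar>f x\<bar> + \<bar>f (smul j x)\<bar>"
        using norm_triangle_ineq4[of "of_real (f x)" "j * of_real (f (smul j x))"] nj x
        by (simp add: u norm_mult)
      moreover have "\<bar>f (smul j x)\<bar> \<le> q x"
        using q(2)[of "smul j x"] csn_scale[OF q(1) x, of j] nj x by simp
      ultimately show ?thesis using q(2)[OF x] by simp
    qed
    then have "u \<in> E'"
      by (intro functionalI[OF lin_u _ csn_mult[OF q(1), of 2]]) (auto simp: u_def)
    \<comment> \<open>The coordinates of \<open>u x\<close> with respect to 1 and \<open>j\<close>
      are \<open>f x\<close> and \<open>- f (smul j x)\<close>; the norm dominates the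
      first.\<close>
    moreover have "\<bar>f x\<bar> \<le> norm (u x)" if x: "x \<in> S" for x
      using abs_real_part_le_norm[OF complex(1), of "f x" "- f (smul j x)"] x
      by (simp add: u scaleR_conv_of_real mult.commute)
    ultimately show ?thesis by blast
  qed
qed

section \<open>Separation of points, Mackey's theorem and uniform boundedness\<close>

lemma real_carrier: "real_carrier (\<lambda>t. smul (of_real t)) S"
proof
  show "module.subspace (\<lambda>t. smul (of_real t)) S"
  proof -
    interpret r: vector_space "\<lambda>t. smul (of_real t)"
      by unfold_locales (simp_all add: scale_left_distrib scale_right_distrib)
    show ?thesis by (rule r.subspaceI) auto
  qed
qed (simp_all add: scale_left_distrib scale_right_distrib)

lemma sublinear_csn: "csn p \<Longrightarrow> sublinear_on S (\<lambda>t. smul (of_real t)) p"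
  by (simp add: sublinear_on_def csn_add csn_scale)

text \<open>For each seminorm \<open>p\<close>, Hahn--Banach gives a real functional whose value at
  \<open>x\<close> is \<open>p x\<close>. It is dominated by the modulus of some functional in
  \<open>E'\<close>, which vanishes at \<open>x\<close>.\<close>

lemma functionals_separate:
  assumes x: "x \<in> S" and zero: "\<And>u. u \<in> E' \<Longrightarrow> u x = 0"
  shows "x = 0"
proof (rule csn_separates[OF x])
  fix p assume p: "csn p"
  obtain f where f: "linear_map_on S (\<lambda>t. smul (of_real t)) (*) f" "\<And>x. x \<in> S \<Longrightarrow> f x \<le> p x"
    and fx: "f x = p x"
    using real_carrier.Hahn_Banach_sublinear[OF real_carrier sublinear_csn[OF p] x] by blast
  have "\<bar>f y\<bar> \<le> p y" if y: "y \<in> S" for y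
  proof -
    have "f (smul (of_real (- 1)) y) = - 1 * f y" using f(1) y unfolding linear_map_on_def by blast
    then show ?thesis using f(2)[of y] f(2)[of "- y"] csn_neg[OF p y] y by simp
  qed
  then obtain u where "u \<in> E'" "\<And>x. x \<in> S \<Longrightarrow> \<bar>f x\<bar> \<le> norm (u x)"
    using real_functional_dominated[OF f(1) p] by blast
  then show "p x = 0" using fx x zero[of u] by fastforce
qed

text \<open>Mackey's theorem, proved one seminorm at a time. The real functional built by the
  gliding hump is dominated by a multiple of \<open>p\<close>, hence by the modulus of an element of
  \<open>E'\<close>, and the latter is bounded on \<open>A\<close>.\<close>

lemma weakly_bounded_imp_vn_bounded:
  assumes A: "A \<subseteq> S" and weak: "\<And>u. u \<in> E' \<Longrightarrow> \<exists>C. \<forall>a\<in>A. norm (u a) \<le> C"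
  shows "vn_bounded smul X A"
  unfolding vn_bounded_iff_csn
proof (intro conjI allI impI)
  fix p assume p: "csn p"
  show "\<exists>C. \<forall>x\<in>A. p x \<le> C"
  proof (rule real_carrier.weakly_bounded_imp_seminorm_bounded[OF real_carrier sublinear_csn[OF p] _ A])
    show "p (- x) = p x" if "x \<in> S" for x using csn_neg[OF p that] .
    fix f assume f: "linear_map_on S (\<lambda>t. smul (of_real t)) (*) f" "\<forall>x\<in>S. \<bar>f x\<bar> \<le> 3/2 * p x"
    have "csn (\<lambda>x. 3/2 * p x)" using csn_mult[OF p, of "3/2"] by simp
    then obtain u where u: "u \<in> E'" "\<And>x. x \<in> S \<Longrightarrow> \<bar>f x\<bar> \<le> norm (u x)"
      using real_functional_dominated[OF f(1)] f(2) by blast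
    then obtain C where "\<forall>a\<in>A. norm (u a) \<le> C" using weak by blast
    then show "\<exists>C. \<forall>a\<in>A. \<bar>f a\<bar> \<le> C" using u(2) A by (meson order_trans subsetD)
  qed
qed (rule A)

text \<open>The Banach--Steinhaus principle for seminorms: the intersection of their unit balls is a
  barrel, and the pointwise bounds say that it absorbs points. It serves both for operators, through
  the seminorms p(M_n x), and for functionals, through their moduli.\<close>

lemma barrelled_csn_bound:
  assumes barrelled: "barrelled_space smul X" and P: "\<And>p. p \<in> P \<Longrightarrow> csn p"
    and bdd: "\<And>x. x \<in> S \<Longrightarrow> \<exists>C. \<forall>p\<in>P. p x \<le> C"
  shows "\<exists>q. csn q \<and> (\<forall>p\<in>P. \<forall>x\<in>S. p x \<le> q x)"
proof -
  define B where "B = {x \<in> S. \<forall>p\<in>P. p x \<le> 1}"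
  have "openin X (S - B)"
    unfolding openin_iff_csn
  proof (intro conjI ballI)
    fix a assume a: "a \<in> S - B"
    then obtain p where p: "p \<in> P" "p a > 1" by (auto simp: B_def not_le)
    let ?r = "1 / (p a - 1)"
    have "{x \<in> S. ?r * p (x - a) < 1} \<subseteq> S - B"
    proof clarify
      fix x assume x: "x \<in> S" "?r * p (x - a) < 1" "x \<in> B"
      then have "p (x - a) < p a - 1" using p by (simp add: field_simps)
      moreover have "p a \<le> p (a - x) + p x" "p (a - x) = p (x - a)"
        using csn_reverse_triangle csn_diff_commute P p a x by auto
      moreover have "p x \<le> 1" using x p by (simp add: B_def)
      ultimately show False by simp
    qed
    then show "\<exists>p. csn p \<and> {x \<in> S. p (x - a) < 1} \<subseteq> S - B"
      using csn_mult[OF P[OF p(1)], of ?r] p(2) by (intro exI[of _ "\<lambda>x. ?r * p x"]) simp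
  qed auto
  then have "closedin X B" by (auto simp: closedin_def B_def)
  moreover have "scale_convex smul B"
    unfolding scale_convex_def
  proof (intro ballI allI impI)
    fix x y and t :: real assume x: "x \<in> B" and y: "y \<in> B" and t: "0 \<le> t \<and> t \<le> 1"
    have "p (smul (of_real t) x + smul (of_real (1 - t)) y) \<le> 1" if p: "p \<in> P" for p
    proof -
      have "p (smul (of_real t) x + smul (of_real (1 - t)) y) \<le> t * p x + (1 - t) * p y"
        using csn_add[OF P[OF p], of "smul (of_real t) x" "smul (of_real (1 - t)) y"] x y t
          csn_scale[OF P[OF p], of x "of_real t"] csn_scale[OF P[OF p], of y "of_real (1 - t)"]
        by (simp add: B_def norm_of_real del: of_real_diff)
      also have "\<dots> \<le> 1" using x y t p by (intro convex_bound_le) (auto simp: B_def)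
      finally show ?thesis .
    qed
    then show "smul (of_real t) x + smul (of_real (1 - t)) y \<in> B" using x y by (auto simp: B_def)
  qed
  moreover have "scale_balanced smul B"
    unfolding scale_balanced_def
  proof (intro ballI allI impI)
    fix x and c :: 'k assume x: "x \<in> B" and c: "norm c \<le> 1"
    have "p (smul c x) \<le> 1" if p: "p \<in> P" for p
    proof -
      have "p (smul c x) = norm c * p x" "0 \<le> p x" "p x \<le> 1"
        using csn_scale csn_nonneg P[OF p] x p by (auto simp: B_def)
      then show ?thesis using c by (simp add: mult_le_one)
    qed
    then show "smul c x \<in> B" using x by (auto simp: B_def)
  qed
  moreover have "absorbs smul B {x}" if x: "x \<in> S" for x
  proof -
    obtain C where C: "\<And>p. p \<in> P \<Longrightarrow> p x \<le> C" using bdd[OF x] by blast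
    have "x \<in> smul c ` B" if c: "\<bar>C\<bar> + 1 \<le> norm c" for c
    proof -
      have c0: "c \<noteq> 0" "norm c > 0" using c by auto
      have "p (smul (inverse c) x) \<le> 1" if p: "p \<in> P" for p
      proof -
        have "p (smul (inverse c) x) = p x / norm c"
          using csn_scale[OF P[OF p] x, of "inverse c"]
          by (simp add: norm_inverse divide_inverse mult.commute)
        also have "\<dots> \<le> 1" using C[OF p] c c0 by simp
        finally show ?thesis .
      qed
      then have "smul (inverse c) x \<in> B" using x by (simp add: B_def)
      then show ?thesis using c0 by (intro image_eqI[of _ _ "smul (inverse c) x"]) auto
    qed
    then show ?thesis unfolding absorbs_def by (intro exI[of _ "\<bar>C\<bar> + 1"]) auto
  qed
  ultimately have "zero_nhd X B" using barrelled by (auto simp: barrelled_space_def barrel_def)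
  then obtain q where q: "csn q" "{x \<in> S. q x < 1} \<subseteq> B" using exists_csn_below_nhd by blast
  have "p x \<le> q x" if p: "p \<in> P" and x: "x \<in> S" for p x
    using csn_le_of_ball[OF P[OF p] q(1) _ x] q(2) p by (auto simp: B_def)
  then show ?thesis using q by blast
qed

section \<open>Cesaro means\<close>

lemma operator_id: "(\<lambda>x. x) \<in> operators"
  by (simp add: continuous_operators_def linear_map_on_def)

lemma operator_comp:
  assumes "A \<in> operators" "B \<in> operators"
  shows "(\<lambda>x. A (B x)) \<in> operators"
  using assms operator_closed[OF assms(2)] continuous_map_compose[of X X B X A]
  by (simp add: continuous_operators_def linear_map_on_def o_def)

lemma operator_funpow: "T \<in> operators \<Longrightarrow> T ^^ m \<in> operators"
proof (induction m)
  case 0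
  then show ?case using operator_id by (simp add: id_def)
next
  case (Suc m)
  then show ?case using operator_comp[of T "T ^^ m"] by (simp add: o_def)
qed

lemma operator_smul:
  assumes A: "A \<in> operators"
  shows "(\<lambda>x. smul c (A x)) \<in> operators"
proof -
  have "continuous_map X X (\<lambda>x. smul c (A x))"
    using A by (intro continuous_map_smul) (auto simp: continuous_operators_def)
  then show ?thesis
    using operator_add[OF A] operator_scale[OF A]
    by (simp add: continuous_operators_def linear_map_on_def scale_right_distrib mult.commute)
qed

lemma operator_plus:
  assumes A: "A \<in> operators" and B: "B \<in> operators"
  shows "(\<lambda>x. A x + B x) \<in> operators"
proof -
  have "continuous_map X X (\<lambda>x. A x + B x)"
    using A B by (intro continuous_map_plus) (auto simp: continuous_operators_def)
  then show ?thesis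
    using operator_add[OF A] operator_scale[OF A] operator_add[OF B] operator_scale[OF B]
    by (simp add: continuous_operators_def linear_map_on_def scale_right_distrib algebra_simps)
qed

lemma operator_minus:
  assumes A: "A \<in> operators" and B: "B \<in> operators"
  shows "(\<lambda>x. A x - B x) \<in> operators"
  using operator_plus[OF A operator_smul[OF B, of "- 1"]] by simp

lemma operator_sum:
  assumes "finite I" "\<And>i. i \<in> I \<Longrightarrow> A i \<in> operators"
  shows "(\<lambda>x. \<Sum>i\<in>I. A i x) \<in> operators"
  using assms
proof (induction I)
  case empty
  then show ?case using operator_smul[OF operator_id, of 0] by simp
next
  case (insert i I)
  then show ?case using operator_plus[of "A i" "\<lambda>x. \<Sum>i\<in>I. A i x"] by simp
qed

lemma operator_of_sum:
  "T \<in> operators \<Longrightarrow> (\<And>i. i \<in> I \<Longrightarrow> f i \<in> S) \<Longrightarrow> T (sum f I) = (\<Sum>i\<in>I. T (f i))"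
  by (induction I rule: infinite_finite_induct) (simp_all add: operator_0 operator_add S_sum)

abbreviation mean :: "('a \<Rightarrow> 'a) \<Rightarrow> nat \<Rightarrow> 'a \<Rightarrow> 'a" where "mean \<equiv> cesaro_mean smul"

lemma mean_operator:
  assumes T: "T \<in> operators"
  shows "mean T n \<in> operators"
  using operator_smul[OF operator_sum[of "{1..n}" "\<lambda>m. T ^^ m"]] operator_funpow[OF T]
  unfolding cesaro_mean_def[abs_def] by simp

lemma mean_0: "mean T 0 x = 0"
  by (simp add: cesaro_mean_def)

text \<open>Expresses the scaled powers by two consecutive means, so that bounds and limits of the
  means carry over to T^n x / n.\<close>

lemma mean_Suc:
  "smul (1 / of_nat (Suc n)) ((T ^^ Suc n) x) =
    mean T (Suc n) x - smul (of_nat n / of_nat (Suc n)) (mean T n x)"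
proof (cases "n = 0")
  case True
  then show ?thesis by (simp add: cesaro_mean_def)
next
  case False
  then have "smul (of_nat n / of_nat (Suc n)) (mean T n x)
      = smul (1 / of_nat (Suc n)) (\<Sum>m=1..n. (T ^^ m) x)"
    by (simp add: cesaro_mean_def)
  then show ?thesis
    by (simp only: cesaro_mean_def sum.cl_ivl_Suc) (simp add: scale_right_distrib)
qed

lemma funpow_fixed: "T y = y \<Longrightarrow> (T ^^ m) y = y"
  by (induction m) auto

lemma mean_fixed:
  assumes "T y = y" "1 \<le> n"
  shows "mean T n y = y"
proof -
  have "(\<Sum>m=1..n. (T ^^ m) y) = smul (of_nat n) y"
    using funpow_fixed[of T y] assms by (simp add: sum_constant_scale)
  then show ?thesis using assms by (simp add: cesaro_mean_def)
qed

lemma mean_commute: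
  assumes T: "T \<in> operators" and x: "x \<in> S"
  shows "mean T n (T x) = T (mean T n x)"
proof -
  have "(T ^^ m) x \<in> S" for m using operator_closed[OF operator_funpow[OF T] x] .
  then show ?thesis
    by (simp add: cesaro_mean_def operator_scale[OF T] operator_of_sum[OF T] S_sum funpow_swap1)
qed

text \<open>The sum telescopes. The last term is written as \<open>T\<close> applied to the scaled
  power so that the continuous seminorm p(T x) can be evaluated on a sequence known to be
  null.\<close>

lemma mean_coboundary:
  assumes T: "T \<in> operators" and z: "z \<in> S"
  shows "mean T n (z - T z) = smul (1 / of_nat n) (T z) - T (smul (1 / of_nat n) ((T ^^ n) z))"
proof -
  have "(\<Sum>m=1..n. (T ^^ m) (z - T z)) = T z - T ((T ^^ n) z)"
    by (induction n)
      (use operator_diff[OF operator_funpow[OF T] z operator_closed[OF T z]]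
        in \<open>simp_all add: funpow_swap1\<close>)
  then show ?thesis
    using operator_closed[OF operator_funpow[OF T] z]
    by (simp add: cesaro_mean_def operator_scale[OF T] scale_right_diff_distrib)
qed

text \<open>Since x - T^m x = (I - T)(x + ... + T^(m-1) x), averaging over m = 1, ..., n gives the
  claim. The index must be positive, because the mean of index 0 is 0 and not an average.\<close>

lemma diff_mean_coboundary:
  assumes T: "T \<in> operators" and x: "x \<in> S" and n: "1 \<le> n"
  shows "\<exists>z\<in>S. x - mean T n x = z - T z"
proof -
  have Tm: "(T ^^ m) x \<in> S" for m using operator_closed[OF operator_funpow[OF T] x] .
  define w where "w m = (\<Sum>k<m. (T ^^ k) x)" for m
  have w: "w m \<in> S" for m unfolding w_def using Tm by (rule S_sum)
  have wm: "x - (T ^^ m) x = w m - T (w m)" for m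
  proof (induction m)
    case 0
    show ?case using operator_0[OF T] by (simp add: w_def)
  next
    case (Suc m)
    have "w (Suc m) - T (w (Suc m)) = (w m - T (w m)) + ((T ^^ m) x - T ((T ^^ m) x))"
      using operator_add[OF T w[of m] Tm[of m]] by (simp add: w_def)
    also have "\<dots> = (x - (T ^^ m) x) + ((T ^^ m) x - T ((T ^^ m) x))"
      by (simp only: Suc)
    finally show ?case by simp
  qed
  let ?z = "smul (1 / of_nat n) (\<Sum>m=1..n. w m)"
  have "?z - T ?z = smul (1 / of_nat n) (\<Sum>m=1..n. w m - T (w m))"
    using w by (simp add: operator_scale[OF T] operator_of_sum[OF T] S_sum sum_subtractf
        scale_right_diff_distrib)
  also have "\<dots> = smul (1 / of_nat n) (\<Sum>m=1..n. x) - mean T n x"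
    by (simp add: cesaro_mean_def sum_subtractf scale_right_diff_distrib flip: wm)
  also have "smul (1 / of_nat n) (\<Sum>m=1..n. x) = x"
    using n by (simp add: sum_constant_scale)
  finally show ?thesis using w by (intro bexI[of _ ?z]) (auto intro: S_sum)
qed

text \<open>Subtracting \<open>y\<close> from both means in \<open>mean_Suc\<close> leaves y - (n /
  (n + 1)) y = y / (n + 1). With \<open>y\<close> the limit of the means the bound tends to 0; with
  \<open>y = 0\<close> it bounds the scaled powers by the means.\<close>

lemma csn_power_le:
  assumes T: "T \<in> operators" and p: "csn p" and x: "x \<in> S" and y: "y \<in> S"
  shows "p (smul (1 / of_nat (Suc n)) ((T ^^ Suc n) x)) \<le>
    p (mean T (Suc n) x - y) + p (mean T n x - y) + p y / real (Suc n)"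
proof -
  let ?c = "of_nat n / of_nat (Suc n) :: 'k" and ?d = "1 / of_nat (Suc n) :: 'k"
  have M: "mean T m x \<in> S" for m using operator_closed[OF mean_operator[OF T] x] .
  have "of_nat (Suc n) \<noteq> (0::'k)" by (rule of_nat_neq_0)
  then have "(of_nat n + 1) / of_nat (Suc n) = (1::'k)" by (simp add: add.commute)
  then have "1 - ?c = ?d" by (metis add_divide_distrib add_diff_cancel_left')
  then have "smul ?d y = y - smul ?c y" by (metis scale_left_diff_distrib scale_one)
  then have eq: "smul ?d ((T ^^ Suc n) x) = (mean T (Suc n) x - y) - smul ?c (mean T n x - y) + smul ?d y"
    unfolding mean_Suc by (simp add: scale_right_diff_distrib)
  have nc: "norm ?c \<le> 1" by (simp add: norm_divide del: of_nat_Suc)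
  have nd: "norm ?d = 1 / real (Suc n)" by (simp add: norm_divide del: of_nat_Suc)
  have "p (smul ?d ((T ^^ Suc n) x)) \<le> p ((mean T (Suc n) x - y) - smul ?c (mean T n x - y)) + p (smul ?d y)"
    unfolding eq using M y by (intro csn_add[OF p]) auto
  also have "\<dots> \<le> p (mean T (Suc n) x - y) + p (smul ?c (mean T n x - y)) + p (smul ?d y)"
    using M y by (intro add_right_mono csn_diff[OF p]) auto
  also have "p (smul ?c (mean T n x - y)) \<le> p (mean T n x - y)"
    using M y nc csn_scale[OF p, of "mean T n x - y" ?c] csn_nonneg[OF p, of "mean T n x - y"]
    by (simp add: mult_left_le_one_le)
  also have "p (smul ?d y) = p y / real (Suc n)"
    using csn_scale[OF p y, of ?d] nd by simp
  finally show ?thesis by simp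
qed

lemma csn_limit_unique:
  assumes f: "\<And>n. f n \<in> S" and a: "a \<in> S" and b: "b \<in> S"
    and "\<And>p. csn p \<Longrightarrow> (\<lambda>n. p (f n - a)) \<longlonglongrightarrow> 0" "\<And>p. csn p \<Longrightarrow> (\<lambda>n. p (f n - b)) \<longlonglongrightarrow> 0"
  shows "a = b"
proof -
  have "p (a - b) = 0" if p: "csn p" for p
  proof -
    have "p (a - b) \<le> p (f n - a) + p (f n - b)" for n
      using csn_triangle[OF p a f b] csn_diff_commute[OF p a f] by simp
    moreover have "(\<lambda>n. p (f n - a) + p (f n - b)) \<longlonglongrightarrow> 0"
      using tendsto_add[OF assms(4,5)[OF p]] by simp
    ultimately have "p (a - b) \<le> 0"
      by (intro LIMSEQ_le_const[of "\<lambda>n. p (f n - a) + p (f n - b)"]) auto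
    then show ?thesis using csn_nonneg[OF p, of "a - b"] a b by simp
  qed
  then have "a - b = 0" using a b by (intro csn_separates) auto
  then show ?thesis by simp
qed

text \<open>Uniform boundedness for the seminorms p(M_n x), with \<open>p\<close> fixed and n
  varying.\<close>

lemma cesaro_boundedI:
  assumes barrelled: "barrelled_space smul X" and T: "T \<in> operators"
    and bdd: "\<And>x. x \<in> S \<Longrightarrow> vn_bounded smul X (range (\<lambda>n. mean T n x))"
  shows "cesaro_bounded smul X T"
  unfolding cesaro_bounded_def equicontinuous_iff_csn
proof (intro conjI allI impI)
  show "{mean T n |n. 1 \<le> n} \<subseteq> operators" using mean_operator[OF T] by auto
  fix p assume p: "csn p"
  have "\<exists>q. csn q \<and> (\<forall>r\<in>range (\<lambda>n x. p (mean T n x)). \<forall>x\<in>S. r x \<le> q x)"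
  proof (rule barrelled_csn_bound[OF barrelled])
    show "csn r" if "r \<in> range (\<lambda>n x. p (mean T n x))" for r
      using that csn_operator[OF mean_operator[OF T] p] by auto
    show "\<exists>C. \<forall>r\<in>range (\<lambda>n x. p (mean T n x)). r x \<le> C" if x: "x \<in> S" for x
      using bdd[OF x] p unfolding vn_bounded_iff_csn by auto
  qed
  then show "\<exists>q. csn q \<and> (\<forall>A\<in>{mean T n |n. 1 \<le> n}. \<forall>x\<in>S. p (A x) \<le> q x)" by auto
qed

lemma mean_ergodic_imp_cesaro_bounded:
  assumes barrelled: "barrelled_space smul X" and T: "T \<in> operators"
    and erg: "mean_ergodic smul X T"
  shows "cesaro_bounded smul X T"
    and "\<And>x. x \<in> S \<Longrightarrow> limitin X (\<lambda>n. smul (1 / of_nat n) ((T ^^ n) x)) 0 sequentially"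
proof -
  obtain P where P: "P \<in> operators"
    and lim: "\<And>x. x \<in> S \<Longrightarrow> limitin X (\<lambda>n. mean T n x) (P x) sequentially"
    using erg by (auto simp: mean_ergodic_def)
  have M: "mean T n x \<in> S" if "x \<in> S" for n x using operator_closed[OF mean_operator[OF T] that] .
  have to0: "(\<lambda>n. p (mean T n x - P x)) \<longlonglongrightarrow> 0" if p: "csn p" and x: "x \<in> S" for p x
    using lim[OF x] limitin_iff_csn[of "\<lambda>n. mean T n x" "P x" sequentially] M[OF x] p by simp
  show "cesaro_bounded smul X T"
  proof (rule cesaro_boundedI[OF barrelled T])
    fix x assume x: "x \<in> S"
    show "vn_bounded smul X (range (\<lambda>n. mean T n x))"
      unfolding vn_bounded_iff_csn
    proof (intro conjI allI impI)
      show "range (\<lambda>n. mean T n x) \<subseteq> S" using M[OF x] by blast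
      fix p assume p: "csn p"
      obtain K where K: "\<And>n. norm (p (mean T n x - P x)) \<le> K"
        using convergent_imp_Bseq[of "\<lambda>n. p (mean T n x - P x)"] to0[OF p x]
        unfolding convergent_def Bseq_def by blast
      have "p (mean T n x) \<le> K + p (P x)" for n
        using csn_reverse_triangle[OF p M[OF x] operator_closed[OF P x], of n] K[of n] by simp
      then show "\<exists>C. \<forall>y\<in>range (\<lambda>n. mean T n x). p y \<le> C" by blast
    qed
  qed
  fix x assume x: "x \<in> S"
  have Tn: "smul (1 / of_nat n) ((T ^^ n) x) \<in> S" for n
    using operator_closed[OF operator_funpow[OF T] x] by blast
  have "(\<lambda>n. p (smul (1 / of_nat n) ((T ^^ n) x))) \<longlonglongrightarrow> 0" if p: "csn p" for p
  proof (rule LIMSEQ_imp_Suc, rule tendsto_sandwich)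
    show "\<forall>\<^sub>F n in sequentially. 0 \<le> p (smul (1 / of_nat (Suc n)) ((T ^^ Suc n) x))"
      using csn_nonneg[OF p Tn] by (intro always_eventually allI)
    show "\<forall>\<^sub>F n in sequentially. p (smul (1 / of_nat (Suc n)) ((T ^^ Suc n) x)) \<le>
        p (mean T (Suc n) x - P x) + p (mean T n x - P x) + p (P x) / real (Suc n)"
      using csn_power_le[OF T p x operator_closed[OF P x]] by (intro always_eventually allI)
    have "(\<lambda>n. p (P x) / real (Suc n)) \<longlonglongrightarrow> 0"
      by (intro LIMSEQ_Suc lim_const_over_n)
    then show "(\<lambda>n. p (mean T (Suc n) x - P x) + p (mean T n x - P x) + p (P x) / real (Suc n))
        \<longlonglongrightarrow> 0"
      using tendsto_add[OF tendsto_add[OF LIMSEQ_Suc[OF to0[OF p x]] to0[OF p x]]] by fastforce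
  qed simp
  then show "limitin X (\<lambda>n. smul (1 / of_nat n) ((T ^^ n) x)) 0 sequentially"
    using limitin_iff_csn[of "\<lambda>n. smul (1 / of_nat n) ((T ^^ n) x)" 0 sequentially] Tn by simp
qed

end

section \<open>The mean ergodic theorem in Montel spaces\<close>

locale montel = lcs +
  assumes montel: "montel_space smul X"
begin

lemma barrelled: "barrelled_space smul X"
  using montel by (simp add: montel_space_def)

lemma compact_closure: "vn_bounded smul X B \<Longrightarrow> compactin X (X closure_of B)"
  using montel by (simp add: montel_space_def)

lemma subset_closure: "vn_bounded smul X B \<Longrightarrow> B \<subseteq> X closure_of B"
  by (rule closure_of_subset) (simp add: vn_bounded_def)

section \<open>Compactness of bounded sets and its consequences for sequences\<close>

lemma bounded_imp_totally_bounded: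
  assumes B: "vn_bounded smul X B" and p: "csn p" and e: "0 < e"
  shows "\<exists>F. finite F \<and> F \<subseteq> S \<and> (\<forall>x\<in>B. \<exists>a\<in>F. p (x - a) < e)"
proof -
  let ?K = "X closure_of B" and ?ball = "\<lambda>a. {x \<in> S. p (x - a) < e}"
  have KS: "?K \<subseteq> S" by (rule closure_of_subset_topspace)
  have "\<exists>\<F>. finite \<F> \<and> \<F> \<subseteq> ?ball ` ?K \<and> ?K \<subseteq> \<Union>\<F>"
  proof (rule compactinD[OF compact_closure[OF B]])
    show "openin X U" if "U \<in> ?ball ` ?K" for U
      using that KS openin_csn_ball[OF p] by blast
    show "?K \<subseteq> \<Union>(?ball ` ?K)" using KS csn_0[OF p] e by auto
  qed
  then obtain \<F> where "finite \<F>" "\<F> \<subseteq> ?ball ` ?K" and cover: "?K \<subseteq> \<Union>\<F>" by blast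
  then obtain F where F: "finite F" "F \<subseteq> ?K" "\<F> = ?ball ` F" by (meson finite_subset_image)
  have "\<exists>a\<in>F. p (x - a) < e" if "x \<in> B" for x
    using that subset_closure[OF B] cover F(3) by blast
  then show ?thesis using F KS by blast
qed

text \<open>The Montel property supplies covering compactness, so cluster points take the place of
  limits of subsequences. Closeness is frequent for each single seminorm; several seminorms are
  treated at once through their sum.\<close>

lemma bounded_imp_cluster_point:
  assumes a: "vn_bounded smul X (range a)"
  shows "\<exists>y\<in>S. \<forall>p e. csn p \<longrightarrow> 0 < e \<longrightarrow> (\<exists>\<^sub>F n in sequentially. p (a n - y) < e)"
proof (rule ccontr)
  assume contra: "\<not> ?thesis"
  let ?K = "X closure_of range a"
  have aK: "a n \<in> ?K" for n using subset_closure[OF a] by blast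
  have KS: "?K \<subseteq> S" by (rule closure_of_subset_topspace)
  \<comment> \<open>Without a cluster point, the open sets that the sequence eventually avoids cover
    the compact closure; some term would then avoid every member of a finite subcover.\<close>
  let ?U = "{U. openin X U \<and> (\<forall>\<^sub>F n in sequentially. a n \<notin> U)}"
  have cover: "?K \<subseteq> \<Union>?U"
  proof
    fix y assume "y \<in> ?K"
    then have y: "y \<in> S" using KS by blast
    then obtain p e where p: "csn p" "0 < e" "\<not> (\<exists>\<^sub>F n in sequentially. p (a n - y) < e)"
      using contra by blast
    have "{x \<in> S. p (x - y) < e} \<in> ?U"
      using openin_csn_ball[OF p(1) y] p(3) by (auto simp: not_frequently elim: eventually_mono)
    moreover have "y \<in> {x \<in> S. p (x - y) < e}" using y p csn_0[OF p(1)] by simp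
    ultimately show "y \<in> \<Union>?U" by blast
  qed
  have "\<exists>\<F>. finite \<F> \<and> \<F> \<subseteq> ?U \<and> ?K \<subseteq> \<Union>\<F>"
    by (rule compactinD[OF compact_closure[OF a] _ cover]) simp
  then obtain \<F> where \<F>: "finite \<F>" "\<F> \<subseteq> ?U" "?K \<subseteq> \<Union>\<F>"
    by (elim exE conjE)
  have "\<forall>\<^sub>F n in sequentially. \<forall>U\<in>\<F>. a n \<notin> U"
    using \<F> by (intro eventually_ball_finite) auto
  then obtain n where "\<forall>U\<in>\<F>. a n \<notin> U" by (auto simp: eventually_sequentially)
  then show False using aK[of n] \<F>(3) by blast
qed

text \<open>Pointwise convergence is uniform on a finite e/2-net with respect to \<open>q\<close>,
  and equicontinuity transfers it to the points near the net. Applied to M_n - P and to T^n /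
  n.\<close>

lemma equicontinuous_uniform_convergence:
  assumes A: "\<And>n. A n \<in> operators"
    and equi: "csn q" "\<And>n x. x \<in> S \<Longrightarrow> p (A n x) \<le> q x"
    and pointwise: "\<And>x. x \<in> S \<Longrightarrow> (\<lambda>n. p (A n x)) \<longlonglongrightarrow> 0"
    and p: "csn p" and B: "vn_bounded smul X B" and e: "0 < e"
  shows "\<forall>\<^sub>F n in sequentially. \<forall>x\<in>B. p (A n x) < e"
proof -
  have BS: "B \<subseteq> S" using B by (simp add: vn_bounded_def)
  obtain F where F: "finite F" "F \<subseteq> S" and near: "\<And>x. x \<in> B \<Longrightarrow> \<exists>a\<in>F. q (x - a) < e / 2"
    using bounded_imp_totally_bounded[OF B equi(1), of "e / 2"] e by auto
  have "\<forall>\<^sub>F n in sequentially. \<forall>a\<in>F. p (A n a) < e / 2"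
  proof (intro eventually_ball_finite F ballI)
    fix a assume "a \<in> F"
    then have "(\<lambda>n. p (A n a)) \<longlonglongrightarrow> 0" using F pointwise by blast
    then show "\<forall>\<^sub>F n in sequentially. p (A n a) < e / 2" using e by (intro order_tendstoD) auto
  qed
  then show ?thesis
  proof eventually_elim
    case (elim n)
    show ?case
    proof
      fix x assume x: "x \<in> B"
      then obtain a where a: "a \<in> F" "q (x - a) < e / 2" using near by blast
      have S: "x \<in> S" "a \<in> S" using x a BS F by auto
      have "p (A n x) \<le> p (A n x - A n a) + p (A n a)"
        using S operator_closed[OF A] by (intro csn_reverse_triangle[OF p]) auto
      also have "A n x - A n a = A n (x - a)" using operator_diff[OF A S] by simp
      also have "p (A n (x - a)) \<le> q (x - a)" using S by (intro equi) auto
      finally show "p (A n x) < e" using a elim by fastforce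
    qed
  qed
qed

text \<open>Index 0 is included because \<open>mean T 0\<close> is 0, so one seminorm bounds the
  whole sequence.\<close>

lemma cesaro_bounded_imp_csn:
  assumes cb: "cesaro_bounded smul X T" and p: "csn p"
  shows "\<exists>q. csn q \<and> (\<forall>n. \<forall>x\<in>S. p (mean T n x) \<le> q x)"
proof -
  obtain q where q: "csn q" and "\<forall>A\<in>{mean T n |n. 1 \<le> n}. \<forall>x\<in>S. p (A x) \<le> q x"
    using equicontinuous_iff_csn[THEN iffD1, OF cb[unfolded cesaro_bounded_def],
        THEN conjunct2, THEN spec, THEN mp, OF p] by (elim exE conjE)
  then have le: "p (mean T n x) \<le> q x" if "1 \<le> n" "x \<in> S" for n x
    using that by auto
  have "p (mean T n x) \<le> q x" if x: "x \<in> S" for n x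
  proof (cases "n = 0")
    case True
    then show ?thesis using csn_nonneg[OF q x] csn_0[OF p] by (simp add: mean_0)
  next
    case False
    then show ?thesis by (intro le x) simp
  qed
  then show ?thesis using q by blast
qed

section \<open>Convergence of the means when they are equicontinuous and T^n x / n is null\<close>

context
  fixes T
  assumes T: "T \<in> operators" and cb: "cesaro_bounded smul X T"
    and pow: "\<And>x. x \<in> S \<Longrightarrow> limitin X (\<lambda>n. smul (1 / of_nat n) ((T ^^ n) x)) 0 sequentially"
begin

lemma mean_closed: "x \<in> S \<Longrightarrow> mean T n x \<in> S"
  using operator_closed[OF mean_operator[OF T]] .

lemma power_closed: "x \<in> S \<Longrightarrow> smul c ((T ^^ n) x) \<in> S"
  using operator_closed[OF operator_funpow[OF T]] by blast

lemma csn_power_tendsto_0: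
  assumes p: "csn p" and x: "x \<in> S"
  shows "(\<lambda>n. p (smul (1 / of_nat n) ((T ^^ n) x))) \<longlonglongrightarrow> 0"
  using pow[OF x] p limitin_iff_csn[of "\<lambda>n. smul (1 / of_nat n) ((T ^^ n) x)" 0 sequentially]
    power_closed[OF x] by simp

lemma csn_coboundary_tendsto_0:
  assumes p: "csn p" and z: "z \<in> S"
  shows "(\<lambda>n. p (mean T n (z - T z))) \<longlonglongrightarrow> 0"
proof (rule tendsto_sandwich)
  have Tz: "T z \<in> S" using operator_closed[OF T z] .
  show "\<forall>\<^sub>F n in sequentially. 0 \<le> p (mean T n (z - T z))"
    using csn_nonneg[OF p mean_closed] z Tz by simp
  have "p (mean T n (z - T z)) \<le> p (T z) / real n + p (T (smul (1 / of_nat n) ((T ^^ n) z)))" for n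
  proof -
    have "p (mean T n (z - T z)) \<le>
        p (smul (1 / of_nat n) (T z)) + p (T (smul (1 / of_nat n) ((T ^^ n) z)))"
      unfolding mean_coboundary[OF T z]
      using Tz operator_closed[OF T power_closed[OF z]] by (intro csn_diff[OF p]) auto
    then show ?thesis using csn_scale[OF p Tz, of "1 / of_nat n"] by (simp add: norm_divide)
  qed
  then show "\<forall>\<^sub>F n in sequentially. p (mean T n (z - T z)) \<le>
      p (T z) / real n + p (T (smul (1 / of_nat n) ((T ^^ n) z)))" by simp
  show "(\<lambda>n. p (T z) / real n + p (T (smul (1 / of_nat n) ((T ^^ n) z)))) \<longlonglongrightarrow> 0"
    using tendsto_add[OF lim_const_over_n csn_power_tendsto_0[OF csn_operator[OF T p] z]] by simp
qed simp

text \<open>Yosida's argument: a cluster point \<open>y\<close> of the means is fixed by \<open>T\<close>, and \<open>x - y\<close> lies in the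
  closure of the range of \<open>I - T\<close>, on which the means tend to \<open>0\<close>.\<close>

lemma means_converge:
  assumes x: "x \<in> S"
  shows "\<exists>y\<in>S. \<forall>p. csn p \<longrightarrow> (\<lambda>n. p (mean T n x - y)) \<longlonglongrightarrow> 0"
proof -
  have "vn_bounded smul X (range (\<lambda>n. mean T n x))"
    unfolding vn_bounded_iff_csn
  proof (intro conjI allI impI)
    show "range (\<lambda>n. mean T n x) \<subseteq> S" using mean_closed[OF x] by blast
    fix p assume "csn p"
    then show "\<exists>C. \<forall>y\<in>range (\<lambda>n. mean T n x). p y \<le> C"
      using cesaro_bounded_imp_csn[OF cb] x by blast
  qed
  then obtain y where y: "y \<in> S"
    and cluster: "\<And>p e. csn p \<Longrightarrow> 0 < e \<Longrightarrow> \<exists>\<^sub>F n in sequentially. p (mean T n x - y) < e"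
    using bounded_imp_cluster_point by meson
  have Tx: "T x \<in> S" and Ty: "T y \<in> S" using operator_closed[OF T] x y by auto
  have "p (y - T y) = 0" if p: "csn p" for p
  proof -
    \<comment> \<open>A cluster point is approached only frequently. The sum makes M_n x close to y
      and T (M_n x) close to T y at the same index n.\<close>
    have r: "csn (\<lambda>v. p v + p (T v))" using csn_plus[OF p csn_operator[OF T p]] .
    have "p (y - T y) \<le> 0 + e" if e: "0 < e" for e
    proof -
      have "\<exists>\<^sub>F n in sequentially. p (mean T n x - y) + p (T (mean T n x - y)) < e / 2"
        using cluster[OF r, of "e / 2"] e by simp
      moreover have "\<forall>\<^sub>F n in sequentially. p (mean T n (x - T x)) < e / 2"
        using csn_coboundary_tendsto_0[OF p x] e by (intro order_tendstoD) auto
      ultimately obtain n where n: "p (mean T n x - y) + p (T (mean T n x - y)) < e / 2"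
        "p (mean T n (x - T x)) < e / 2"
        using frequently_ex[OF frequently_eventually_conj] by meson
      have M: "mean T n x \<in> S" "T (mean T n x) \<in> S" using mean_closed operator_closed[OF T] x by auto
      have "p (y - T y) \<le> p (y - mean T n x) + p (mean T n x - T y)"
        using csn_triangle[OF p y M(1) Ty] .
      also have "p (mean T n x - T y) \<le> p (mean T n x - T (mean T n x)) + p (T (mean T n x) - T y)"
        using csn_triangle[OF p M Ty] .
      also have "T (mean T n x) - T y = T (mean T n x - y)" using operator_diff[OF T M(1) y] by simp
      also have "mean T n x - T (mean T n x) = mean T n (x - T x)"
        using operator_diff[OF mean_operator[OF T] x Tx] mean_commute[OF T x] by simp
      also have "p (y - mean T n x) = p (mean T n x - y)" using csn_diff_commute[OF p y M(1)] .
      finally show ?thesis using n by simp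
    qed
    then have "p (y - T y) \<le> 0" by (rule field_le_epsilon)
    then show ?thesis using csn_nonneg[OF p, of "y - T y"] y Ty by simp
  qed
  then have "y - T y = 0" using y Ty by (intro csn_separates) auto
  then have fixed: "T y = y" by simp
  have "(\<lambda>n. p (mean T n x - y)) \<longlonglongrightarrow> 0" if p: "csn p" for p
  proof (rule tendstoI)
    fix e :: real assume e: "0 < e"
    obtain q where q: "csn q" "\<And>n v. v \<in> S \<Longrightarrow> p (mean T n v) \<le> q v"
      using cesaro_bounded_imp_csn[OF cb p] by blast
    have "\<exists>\<^sub>F n in sequentially. q (mean T n x - y) < e / 2"
      using cluster[OF q(1), of "e / 2"] e by simp
    from frequently_eventually_conj[OF this eventually_ge_at_top[of 1]]
    obtain m where m: "q (mean T m x - y) < e / 2" "1 \<le> m" using frequently_ex by blast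
    obtain z where z: "z \<in> S" "x - mean T m x = z - T z"
      using diff_mean_coboundary[OF T x m(2)] by blast
    have Tz: "T z \<in> S" and M: "mean T m x \<in> S" using operator_closed[OF T z(1)] mean_closed[OF x] .
    \<comment> \<open>Here \<open>m\<close> stays fixed while n grows: M_n sends the first summand
      to 0, and the second stays below q(M_m x - y) for every n. This turns frequent closeness into
      convergence.\<close>
    have split: "x - y = (z - T z) + (mean T m x - y)" by (simp flip: z(2))
    have "\<forall>\<^sub>F n in sequentially. p (mean T n (z - T z)) < e / 2"
      using csn_coboundary_tendsto_0[OF p z(1)] e by (intro order_tendstoD) auto
    then have "\<forall>\<^sub>F n in sequentially. p (mean T n (z - T z)) < e / 2 \<and> 1 \<le> n"
      using eventually_ge_at_top by (rule eventually_conj)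
    then show "\<forall>\<^sub>F n in sequentially. dist (p (mean T n x - y)) 0 < e"
    proof eventually_elim
      case (elim n)
      have "mean T n x - y = mean T n (x - y)"
        using operator_diff[OF mean_operator[OF T] x y] mean_fixed[of T y n, OF fixed] elim by simp
      also have "\<dots> = mean T n (z - T z) + mean T n (mean T m x - y)"
        unfolding split using z Tz M y by (intro operator_add[OF mean_operator[OF T]]) auto
      also have "p \<dots> \<le> p (mean T n (z - T z)) + p (mean T n (mean T m x - y))"
        using z Tz M y mean_closed by (intro csn_add[OF p]) auto
      also have "p (mean T n (mean T m x - y)) \<le> q (mean T m x - y)" using M y by (intro q) auto
      finally have "p (mean T n x - y) < e" using elim m by simp
      then show ?case using csn_nonneg[OF p, of "mean T n x - y"] mean_closed[OF x] y by simp
    qed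
  qed
  then show ?thesis using y by blast
qed

text \<open>Linearity of the limit comes from uniqueness of limits, continuity from the seminorm
  that dominates all means and hence their limit.\<close>

lemma mean_projection:
  shows "\<exists>P\<in>operators. \<forall>x\<in>S. \<forall>p. csn p \<longrightarrow> (\<lambda>n. p (mean T n x - P x)) \<longlonglongrightarrow> 0"
proof -
  obtain P where P: "\<And>x. x \<in> S \<Longrightarrow> P x \<in> S"
    and lim: "\<And>x p. x \<in> S \<Longrightarrow> csn p \<Longrightarrow> (\<lambda>n. p (mean T n x - P x)) \<longlonglongrightarrow> 0"
    using means_converge by metis
  have "P \<in> operators"
  proof (rule operatorI)
    show "linear_map_on S smul smul P"
      unfolding linear_map_on_def
    proof (intro conjI ballI allI)
      fix x y assume x: "x \<in> S" and y: "y \<in> S"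
      show "P (x + y) = P x + P y"
      proof (rule csn_limit_unique[of "\<lambda>n. mean T n (x + y)"])
        fix p assume p: "csn p"
        show "(\<lambda>n. p (mean T n (x + y) - P (x + y))) \<longlonglongrightarrow> 0" using lim x y p by simp
        have "p (mean T n (x + y) - (P x + P y)) \<le> p (mean T n x - P x) + p (mean T n y - P y)" for n
          using csn_add[OF p, of "mean T n x - P x" "mean T n y - P y"] x y P mean_closed
            operator_add[OF mean_operator[OF T] x y] by (simp add: algebra_simps)
        moreover have "0 \<le> p (mean T n (x + y) - (P x + P y))" for n
          using csn_nonneg[OF p] x y P mean_closed by simp
        ultimately have "\<forall>\<^sub>F n in sequentially. norm (p (mean T n (x + y) - (P x + P y)))
            \<le> p (mean T n x - P x) + p (mean T n y - P y)"
          by simp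
        moreover have "(\<lambda>n. p (mean T n x - P x) + p (mean T n y - P y)) \<longlonglongrightarrow> 0"
          using tendsto_add[OF lim[OF x p] lim[OF y p]] by simp
        ultimately show "(\<lambda>n. p (mean T n (x + y) - (P x + P y))) \<longlonglongrightarrow> 0"
          by (rule Lim_null_comparison)
      qed (use x y P mean_closed in auto)
    next
      fix c x assume x: "x \<in> S"
      show "P (smul c x) = smul c (P x)"
      proof (rule csn_limit_unique[of "\<lambda>n. mean T n (smul c x)"])
        fix p assume p: "csn p"
        show "(\<lambda>n. p (mean T n (smul c x) - P (smul c x))) \<longlonglongrightarrow> 0" using lim x p by simp
        have "p (mean T n (smul c x) - smul c (P x)) = norm c * p (mean T n x - P x)" for n
          using csn_scale[OF p, of "mean T n x - P x" c] x P mean_closed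
            operator_scale[OF mean_operator[OF T] x] by (simp add: scale_right_diff_distrib)
        then show "(\<lambda>n. p (mean T n (smul c x) - smul c (P x))) \<longlonglongrightarrow> 0"
          using tendsto_mult_left[OF lim[OF x p], of "norm c"] by simp
      qed (use x P mean_closed in auto)
    qed
    fix p assume p: "csn p"
    then obtain q where q: "csn q" "\<And>n v. v \<in> S \<Longrightarrow> p (mean T n v) \<le> q v"
      using cesaro_bounded_imp_csn[OF cb p] by blast
    have "p (P x) \<le> q x" if x: "x \<in> S" for x
    proof (rule LIMSEQ_le_const)
      show "(\<lambda>n. p (mean T n x - P x) + q x) \<longlonglongrightarrow> q x"
        using tendsto_add[OF lim[OF x p] tendsto_const[of "q x"]] by simp
      have "p (P x) \<le> p (mean T n x - P x) + q x" for n
        using csn_reverse_triangle[OF p P[OF x] mean_closed[OF x]] q(2)[OF x]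
          csn_diff_commute[OF p P[OF x] mean_closed[OF x]] by (metis add_left_mono order_trans)
      then show "\<exists>N. \<forall>n\<ge>N. p (P x) \<le> p (mean T n x - P x) + q x" by blast
    qed
    then show "\<exists>q. csn q \<and> (\<forall>x\<in>S. p (P x) \<le> q x)" using q by blast
  qed (rule P)
  then show ?thesis using lim by blast
qed

lemma cesaro_bounded_imp_uniformly_mean_ergodic: "uniformly_mean_ergodic smul X T"
proof -
  obtain P where P: "P \<in> operators"
    and lim: "\<And>x p. x \<in> S \<Longrightarrow> csn p \<Longrightarrow> (\<lambda>n. p (mean T n x - P x)) \<longlonglongrightarrow> 0"
    using mean_projection by blast
  have "\<forall>\<^sub>F n in sequentially. \<forall>x\<in>B. mean T n x - P x \<in> V"
    if B: "vn_bounded smul X B" and V: "zero_nhd X V" for B V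
  proof -
    obtain p where p: "csn p" "{x \<in> S. p x < 1} \<subseteq> V" using exists_csn_below_nhd[OF V] by blast
    obtain q where q: "csn q" "\<And>n v. v \<in> S \<Longrightarrow> p (mean T n v) \<le> q v"
      using cesaro_bounded_imp_csn[OF cb p(1)] by blast
    have "\<forall>\<^sub>F n in sequentially. \<forall>x\<in>B. p (mean T n x - P x) < 1"
    proof (rule equicontinuous_uniform_convergence[OF _ _ _ _ p(1) B])
      show "(\<lambda>x. mean T n x - P x) \<in> operators" for n
        using operator_minus[OF mean_operator[OF T] P] .
      show "csn (\<lambda>x. q x + p (P x))" using csn_plus[OF q(1) csn_operator[OF P p(1)]] .
      show "p (mean T n x - P x) \<le> q x + p (P x)" if x: "x \<in> S" for n x
        using csn_diff[OF p(1) mean_closed[OF x] operator_closed[OF P x], of n] q(2)[OF x, of n] by simp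
      show "(\<lambda>n. p (mean T n x - P x)) \<longlonglongrightarrow> 0" if "x \<in> S" for x using lim[OF that p(1)] .
    qed simp
    then show ?thesis
    proof eventually_elim
      case (elim n)
      show ?case
      proof
        fix x assume x: "x \<in> B"
        then have "x \<in> S" using B by (auto simp: vn_bounded_def)
        then have "mean T n x - P x \<in> S" using mean_closed operator_closed[OF P] by blast
        then show "mean T n x - P x \<in> V" using elim x p(2) by blast
      qed
    qed
  qed
  moreover have "limitin X (\<lambda>n. mean T n x) (P x) sequentially" if x: "x \<in> S" for x
    using limitin_iff_csn[of "\<lambda>n. mean T n x" "P x" sequentially] mean_closed[OF x]
      operator_closed[OF P x] lim[OF x] by simp
  ultimately show ?thesis unfolding uniformly_mean_ergodic_def using P by blast
qed

text \<open>Each scaled power is a combination of two consecutive means, hence the bound 2 q. With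
  the modulus of a functional as \<open>p\<close>, this is the strong convergence needed for the
  transpose.\<close>

lemma power_uniform:
  assumes B: "vn_bounded smul X B" and p: "csn p" and e: "0 < e"
  shows "\<forall>\<^sub>F n in sequentially. \<forall>x\<in>B. p (smul (1 / of_nat n) ((T ^^ n) x)) < e"
proof -
  obtain q where q: "csn q" "\<And>n v. v \<in> S \<Longrightarrow> p (mean T n v) \<le> q v"
    using cesaro_bounded_imp_csn[OF cb p] by blast
  show ?thesis
  proof (rule equicontinuous_uniform_convergence[OF _ _ _ _ p B e])
    show "(\<lambda>x. smul (1 / of_nat n) ((T ^^ n) x)) \<in> operators" for n
      using operator_smul[OF operator_funpow[OF T]] .
    show "csn (\<lambda>x. 2 * q x)" using csn_mult[OF q(1), of 2] by simp
    show "p (smul (1 / of_nat n) ((T ^^ n) x)) \<le> 2 * q x" if x: "x \<in> S" for n x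
    proof (cases n)
      case 0
      then show ?thesis using csn_0[OF p] csn_nonneg[OF q(1) x] by simp
    next
      case (Suc m)
      have "p (smul (1 / of_nat (Suc m)) ((T ^^ Suc m) x)) \<le> p (mean T (Suc m) x) + p (mean T m x)"
        using csn_power_le[OF T p x, of 0 m] csn_0[OF p] by simp
      then show ?thesis using q(2)[OF x, of "Suc m"] q(2)[OF x, of m] Suc by simp
    qed
    show "(\<lambda>n. p (smul (1 / of_nat n) ((T ^^ n) x))) \<longlonglongrightarrow> 0" if "x \<in> S" for x
      using csn_power_tendsto_0[OF p that] .
  qed
qed

end

text \<open>The means of a point are bounded by Mackey's theorem, and a bounded weakly null sequence is
  null, since each of its cluster points is annihilated by the dual.\<close>

lemma weak_imp_cesaro_bounded:
  assumes T: "T \<in> operators"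
    and wb: "\<And>u x. u \<in> E' \<Longrightarrow> x \<in> S \<Longrightarrow> \<exists>C. \<forall>n. norm (u (mean T n x)) \<le> C"
    and wn: "\<And>u x. u \<in> E' \<Longrightarrow> x \<in> S \<Longrightarrow> (\<lambda>n. u (smul (1 / of_nat n) ((T ^^ n) x))) \<longlonglongrightarrow> 0"
  shows "cesaro_bounded smul X T"
    and "\<And>x. x \<in> S \<Longrightarrow> limitin X (\<lambda>n. smul (1 / of_nat n) ((T ^^ n) x)) 0 sequentially"
proof -
  have M: "mean T n x \<in> S" if "x \<in> S" for n x using operator_closed[OF mean_operator[OF T] that] .
  have bdd: "vn_bounded smul X (range (\<lambda>n. mean T n x))" if x: "x \<in> S" for x
    by (rule weakly_bounded_imp_vn_bounded) (use M[OF x] wb[OF _ x] in auto)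
  show "cesaro_bounded smul X T" by (rule cesaro_boundedI[OF barrelled T bdd])
  fix x assume x: "x \<in> S"
  define a where "a n = smul (1 / of_nat n) ((T ^^ n) x)" for n
  have aS: "a n \<in> S" for n unfolding a_def using operator_closed[OF operator_funpow[OF T] x] by blast
  have a_bdd: "\<exists>C. \<forall>n. p (a n) \<le> C" if p: "csn p" for p
  proof -
    obtain C where "\<forall>y\<in>range (\<lambda>n. mean T n x). p y \<le> C"
      using vn_bounded_csn[OF bdd[OF x] p] by (elim exE)
    then have C: "p (mean T n x) \<le> C" for n by simp
    have "p (a n) \<le> 2 * \<bar>C\<bar>" for n
    proof (cases n)
      case 0
      then show ?thesis using csn_0[OF p] by (simp add: a_def)
    next
      case (Suc m)
      show ?thesis
        using csn_power_le[OF T p x, of 0 m] csn_0[OF p] C[of m] C[of "Suc m"] Suc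
        by (simp add: a_def)
    qed
    then show ?thesis by blast
  qed
  have "limitin X a 0 sequentially"
    unfolding limitin_iff_csn[OF aS]
  proof (intro conjI allI impI)
    fix p assume p: "csn p"
    show "(\<lambda>n. p (a n - 0)) \<longlonglongrightarrow> 0"
    proof (rule ccontr)
      assume "\<not> ?thesis"
      then obtain e where e: "0 < e" "\<not> (\<forall>\<^sub>F n in sequentially. p (a n) < e)"
        using csn_nonneg[OF p aS] by (auto simp: tendsto_iff)
      then have "\<exists>\<^sub>F n in sequentially. e \<le> p (a n)"
        by (simp add: frequently_def not_le)
      \<comment> \<open>The subsequence only stays away from 0 in \<open>p\<close>. Its cluster
        point is annihilated by \<open>E'\<close>, hence is 0, which contradicts the lower bound
        \<open>e\<close>.\<close>
      then obtain r :: "nat \<Rightarrow> nat" where r: "strict_mono r" "\<And>n. e \<le> p (a (r n))"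
        using infinite_enumerate[of "{n. e \<le> p (a n)}"]
        by (auto simp: frequently_cofinite cofinite_eq_sequentially[symmetric])
      have "vn_bounded smul X (range (\<lambda>n. a (r n)))"
        unfolding vn_bounded_iff_csn using a_bdd aS by fastforce
      from bounded_imp_cluster_point[OF this] obtain y where y: "y \<in> S"
        and "\<forall>p e. csn p \<longrightarrow> 0 < e \<longrightarrow> (\<exists>\<^sub>F n in sequentially. p (a (r n) - y) < e)"
        by (elim bexE)
      then have cluster: "\<exists>\<^sub>F n in sequentially. p (a (r n) - y) < e" if "csn p" "0 < e" for p e
        using that by simp
      have "u y = 0" if u: "u \<in> E'" for u
      proof -
        have "norm (u y) \<le> 0 + d" if d: "0 < d" for d
        proof -
          have "(\<lambda>n. u (a (r n))) \<longlonglongrightarrow> 0"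
            using LIMSEQ_subseq_LIMSEQ[OF wn[OF u x] r(1)] by (simp add: a_def o_def)
          then have "\<forall>\<^sub>F n in sequentially. norm (u (a (r n))) < d / 2"
            using tendstoD[of "\<lambda>n. u (a (r n))" 0 sequentially "d / 2"] d by simp
          \<comment> \<open>The modulus of \<open>u\<close> is itself a continuous seminorm, so the
            cluster property applies to it.\<close>
          moreover have "\<exists>\<^sub>F n in sequentially. norm (u (a (r n) - y)) < d / 2"
            using cluster[OF csn_functional[OF u], of "d / 2"] d by simp
          ultimately obtain n where "norm (u (a (r n) - y)) < d / 2" "norm (u (a (r n))) < d / 2"
            using frequently_ex[OF frequently_eventually_conj] by meson
          then show ?thesis
            using norm_triangle_ineq4[of "u (a (r n))" "u (a (r n) - y)"] functional_diff[OF u aS y]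
            by simp
        qed
        then have "norm (u y) \<le> 0" by (rule field_le_epsilon)
        then show ?thesis by simp
      qed
      then have "y = 0" by (rule functionals_separate[OF y])
      then obtain n where "p (a (r n)) < e" using frequently_ex[OF cluster[OF p e(1)]] by auto
      then show False using r(2)[of n] by simp
    qed
  qed simp
  then show "limitin X (\<lambda>n. smul (1 / of_nat n) ((T ^^ n) x)) 0 sequentially"
    by (simp add: a_def[abs_def])
qed

end

section \<open>The strong dual\<close>

lemma sum_fun_apply: "(\<Sum>i\<in>I. f i) x = (\<Sum>i\<in>I. f i x)"
  by (induction I rule: infinite_finite_induct) auto

context lcs
begin

abbreviation D :: "('a \<Rightarrow> 'k) topology" where "D \<equiv> strong_dual smul X"

lemma dual_zero: "0 \<in> E'"
  by (simp add: dual_space_def linear_map_on_def zero_fun_def)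

lemma dual_plus:
  assumes u: "u \<in> E'" and v: "v \<in> E'"
  shows "u + v \<in> E'"
proof (rule functionalI[OF _ _ csn_plus[OF csn_functional[OF u] csn_functional[OF v]]])
  show "linear_map_on S smul (*) (u + v)"
    by (simp add: linear_map_on_def functional_add[OF u] functional_add[OF v]
        functional_scale[OF u] functional_scale[OF v] distrib_left)
  show "(u + v) x = 0" if "x \<notin> S" for x
    using functional_outside[OF u that] functional_outside[OF v that] by simp
qed (simp add: norm_triangle_ineq)

lemma dual_scale_closed:
  assumes u: "u \<in> E'"
  shows "dual_scale c u \<in> E'"
proof (rule functionalI[OF _ _ csn_mult[OF csn_functional[OF u], of "norm c + 1"]])
  show "linear_map_on S smul (*) (dual_scale c u)"
    by (simp add: linear_map_on_def dual_scale_def functional_add[OF u] functional_scale[OF u] distrib_left)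
  show "dual_scale c u x = 0" if "x \<notin> S" for x
    using functional_outside[OF u that] by (simp add: dual_scale_def)
  show "0 < norm c + 1" by (simp add: add_nonneg_pos)
  show "norm (dual_scale c u x) \<le> (norm c + 1) * norm (u x)" for x
    by (simp add: dual_scale_def norm_mult distrib_right)
qed

lemma dual_minus: "u \<in> E' \<Longrightarrow> v \<in> E' \<Longrightarrow> u - v \<in> E'"
proof -
  assume u: "u \<in> E'" and v: "v \<in> E'"
  have eq: "u - v = u + dual_scale (- 1) v" by (simp add: dual_scale_def fun_eq_iff)
  show "u - v \<in> E'" unfolding eq by (rule dual_plus[OF u dual_scale_closed[OF v]])
qed

section \<open>Transposes and their Cesaro means\<close>

lemma transpose_apply: "x \<in> S \<Longrightarrow> transpose_operator X A u x = u (A x)"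
  by (simp add: transpose_operator_def)

lemma transpose_closed:
  assumes A: "A \<in> operators" and u: "u \<in> E'"
  shows "transpose_operator X A u \<in> E'"
proof (rule functionalI[OF _ _ csn_operator[OF A csn_functional[OF u]]])
  show "linear_map_on S smul (*) (transpose_operator X A u)"
    using operator_closed[OF A]
    by (simp add: linear_map_on_def transpose_apply operator_add[OF A] operator_scale[OF A]
        functional_add[OF u] functional_scale[OF u])
qed (simp_all add: transpose_operator_def)

lemma transpose_funpow_apply:
  assumes T: "T \<in> operators"
  shows "x \<in> S \<Longrightarrow> (transpose_operator X T ^^ m) u x = u ((T ^^ m) x)"
proof (induction m arbitrary: x)
  case (Suc m)
  have "(transpose_operator X T ^^ Suc m) u x = (transpose_operator X T ^^ m) u (T x)"
    using Suc.prems by (simp add: transpose_apply)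
  also have "\<dots> = u ((T ^^ m) (T x))" using Suc operator_closed[OF T] by blast
  finally show ?case by (simp add: funpow_swap1)
qed simp

lemma transpose_funpow_closed:
  "T \<in> operators \<Longrightarrow> u \<in> E' \<Longrightarrow> (transpose_operator X T ^^ m) u \<in> E'"
  by (induction m) (simp_all add: transpose_closed)

abbreviation dual_mean :: "('a \<Rightarrow> 'a) \<Rightarrow> nat \<Rightarrow> ('a \<Rightarrow> 'k) \<Rightarrow> 'a \<Rightarrow> 'k"
  where "dual_mean T \<equiv> cesaro_mean dual_scale (transpose_operator X T)"

text \<open>Both sides vanish off \<open>S\<close>, because elements of \<open>E'\<close> do; so the
  computation on \<open>S\<close> gives an equality of functions.\<close>

lemma dual_mean_eq:
  assumes T: "T \<in> operators" and u: "u \<in> E'"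
  shows "dual_mean T n u = transpose_operator X (mean T n) u"
proof
  fix x
  show "dual_mean T n u x = transpose_operator X (mean T n) u x"
  proof (cases "x \<in> S")
    case True
    have Tm: "(T ^^ m) x \<in> S" for m using operator_closed[OF operator_funpow[OF T] True] .
    then show ?thesis
      using True
      by (simp add: cesaro_mean_def dual_scale_def sum_fun_apply transpose_apply
          transpose_funpow_apply[OF T] functional_scale[OF u] functional_sum[OF u] S_sum)
  next
    case False
    then have "(transpose_operator X T ^^ m) u x = 0" for m
      using functional_outside transpose_funpow_closed[OF T u] by blast
    then show ?thesis
      using False
      by (simp add: cesaro_mean_def dual_scale_def sum_fun_apply transpose_operator_def)
  qed
qed

lemma dual_mean_closed: "T \<in> operators \<Longrightarrow> u \<in> E' \<Longrightarrow> dual_mean T n u \<in> E'"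
  by (simp add: dual_mean_eq transpose_closed mean_operator)

lemma dual_mean_apply: "T \<in> operators \<Longrightarrow> u \<in> E' \<Longrightarrow> x \<in> S \<Longrightarrow> dual_mean T n u x = u (mean T n x)"
  by (simp add: dual_mean_eq transpose_apply)

lemma vn_bounded_image:
  assumes A: "A \<in> operators" and B: "vn_bounded smul X B"
  shows "vn_bounded smul X (A ` B)"
  unfolding vn_bounded_iff_csn
proof (intro conjI allI impI)
  show "A ` B \<subseteq> S" using B operator_closed[OF A] by (auto simp: vn_bounded_def)
  show "\<exists>C. \<forall>x\<in>A ` B. p x \<le> C" if p: "csn p" for p
    using vn_bounded_csn[OF B csn_operator[OF A p]] by simp
qed

lemma vn_bounded_singleton: "x \<in> S \<Longrightarrow> vn_bounded smul X {x}"
  by (auto simp: vn_bounded_iff_csn)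

lemma transpose_operator_dual:
  assumes A: "A \<in> operators"
  shows "transpose_operator X A \<in> continuous_operators dual_scale D"
proof -
  have "linear_map_on E' dual_scale dual_scale (transpose_operator X A)"
    by (auto simp: linear_map_on_def transpose_operator_def dual_scale_def)
  moreover have "continuous_map D D (transpose_operator X A)"
    unfolding continuous_map_def topspace_strong_dual
  proof (intro conjI allI impI)
    show "transpose_operator X A \<in> E' \<rightarrow> E'" using transpose_closed[OF A] by blast
    fix W assume W: "openin D W"
    show "openin D {u \<in> E'. transpose_operator X A u \<in> W}"
      unfolding openin_strong_dual
    proof (intro conjI ballI)
      fix u assume u: "u \<in> {u \<in> E'. transpose_operator X A u \<in> W}"
      then obtain B e where B: "vn_bounded smul X B" "e > 0"
        and ball: "dual_ball smul X (transpose_operator X A u) B e \<subseteq> W"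
        using W unfolding openin_strong_dual by blast
      have BS: "B \<subseteq> S" using B by (simp add: vn_bounded_def)
      have "transpose_operator X A v \<in> W" if v: "v \<in> dual_ball smul X u (A ` B) e" for v
      proof -
        have "transpose_operator X A v \<in> dual_ball smul X (transpose_operator X A u) B e"
          using v BS transpose_closed[OF A] by (auto simp: dual_ball_def transpose_apply)
        then show ?thesis using ball by blast
      qed
      then have "dual_ball smul X u (A ` B) e \<subseteq> {u \<in> E'. transpose_operator X A u \<in> W}"
        by (auto simp: dual_ball_def)
      then show "\<exists>B e. vn_bounded smul X B \<and> e > 0 \<and>
          dual_ball smul X u B e \<subseteq> {u \<in> E'. transpose_operator X A u \<in> W}"
        using vn_bounded_image[OF A B(1)] B(2) by blast
    qed auto
  qed
  ultimately show ?thesis by (simp add: continuous_operators_def)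
qed

lemma dual_mean_operator:
  assumes T: "T \<in> operators"
  shows "dual_mean T n \<in> continuous_operators dual_scale D"
proof -
  have eq: "dual_mean T n u = transpose_operator X (mean T n) u" if "u \<in> E'" for u
    using dual_mean_eq[OF T that] .
  note op = transpose_operator_dual[OF mean_operator[OF T], of n]
  have "continuous_map D D (dual_mean T n)"
    by (rule continuous_map_eq[of D D "transpose_operator X (mean T n)"])
      (use op eq in \<open>simp_all add: continuous_operators_def\<close>)
  moreover have "linear_map_on E' dual_scale dual_scale (dual_mean T n)"
    using op by (simp add: continuous_operators_def linear_map_on_def eq dual_plus dual_scale_closed)
  ultimately show ?thesis by (simp add: continuous_operators_def)
qed

section \<open>Neighbourhoods and limits in the strong dual\<close>

lemma dual_ball_contains_open:
  assumes u: "u \<in> E'" and B: "vn_bounded smul X B" and e: "0 < e"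
  shows "\<exists>W. openin D W \<and> u \<in> W \<and> W \<subseteq> dual_ball smul X u B e"
proof -
  \<comment> \<open>The slack \<open>d\<close> is uniform over \<open>B\<close>. Strict inequality
    at each point of the possibly infinite set \<open>B\<close> would leave no radius for a smaller
    ball.\<close>
  let ?W = "{v \<in> E'. \<exists>d>0. \<forall>x\<in>B. norm (v x - u x) \<le> e - d}"
  have "openin D ?W"
    unfolding openin_strong_dual
  proof (intro conjI ballI)
    fix v assume "v \<in> ?W"
    then obtain d where d: "0 < d" "\<And>x. x \<in> B \<Longrightarrow> norm (v x - u x) \<le> e - d" by blast
    have "w \<in> ?W" if w: "w \<in> dual_ball smul X v B (d / 2)" for w
    proof -
      have "norm (w x - u x) \<le> e - d / 2" if x: "x \<in> B" for x
      proof -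
        have "norm (w x - u x) \<le> norm (w x - v x) + norm (v x - u x)"
          using norm_triangle_ineq[of "w x - v x" "v x - u x"] by simp
        moreover have "norm (w x - v x) \<le> d / 2" using w x by (simp add: dual_ball_def)
        ultimately show ?thesis using d(2)[OF x] by simp
      qed
      then show ?thesis using w d(1) by (auto simp: dual_ball_def intro!: exI[of _ "d / 2"])
    qed
    then show "\<exists>B e. vn_bounded smul X B \<and> e > 0 \<and> dual_ball smul X v B e \<subseteq> ?W"
      using B d(1) by (intro exI[of _ B] exI[of _ "d / 2"]) auto
  qed auto
  moreover have "u \<in> ?W" using u e by (auto intro!: exI[of _ e])
  moreover have "?W \<subseteq> dual_ball smul X u B e" by (force simp: dual_ball_def)
  ultimately show ?thesis by blast
qed

lemma zero_nhd_dual_ball: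
  assumes "vn_bounded smul X B" "0 < e"
  shows "zero_nhd D (dual_ball smul X 0 B e)"
  using dual_ball_contains_open[OF dual_zero assms] unfolding zero_nhd_def
  by (auto simp: dual_ball_def)

lemma zero_nhd_dual:
  assumes "zero_nhd D V"
  shows "\<exists>B e. vn_bounded smul X B \<and> 0 < e \<and> dual_ball smul X 0 B e \<subseteq> V"
proof -
  obtain U where U: "openin D U" "0 \<in> U" "U \<subseteq> V" using assms by (auto simp: zero_nhd_def)
  then have "\<exists>B e. vn_bounded smul X B \<and> 0 < e \<and> dual_ball smul X 0 B e \<subseteq> U"
    unfolding openin_strong_dual by blast
  then show ?thesis using U(3) by (meson order_trans)
qed

lemma limitin_dual:
  assumes f: "\<And>n. f n \<in> E'"
  shows "limitin D f l F \<longleftrightarrow> l \<in> E' \<and> (\<forall>B e. vn_bounded smul X B \<longrightarrow> 0 < e \<longrightarrow>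
    (\<forall>\<^sub>F n in F. \<forall>x\<in>B. norm (f n x - l x) \<le> e))"
proof (intro iffI conjI allI impI)
  assume L: "limitin D f l F"
  then show l: "l \<in> E'" by (simp add: limitin_def)
  fix B and e :: real assume "vn_bounded smul X B" "0 < e"
  then obtain W where W: "openin D W" "l \<in> W" "W \<subseteq> dual_ball smul X l B e"
    using dual_ball_contains_open[OF l] by blast
  then have "\<forall>\<^sub>F n in F. f n \<in> W" using L by (simp add: limitin_def)
  then show "\<forall>\<^sub>F n in F. \<forall>x\<in>B. norm (f n x - l x) \<le> e"
    by eventually_elim (use W(3) in \<open>auto simp: dual_ball_def\<close>)
next
  assume R: "l \<in> E' \<and> (\<forall>B e. vn_bounded smul X B \<longrightarrow> 0 < e \<longrightarrow>
    (\<forall>\<^sub>F n in F. \<forall>x\<in>B. norm (f n x - l x) \<le> e))"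
  show "limitin D f l F"
    unfolding limitin_def topspace_strong_dual
  proof (intro conjI allI impI)
    show "l \<in> E'" using R by blast
    fix U assume "openin D U \<and> l \<in> U"
    then obtain B e where B: "vn_bounded smul X B" "0 < e" "dual_ball smul X l B e \<subseteq> U"
      unfolding openin_strong_dual by blast
    then have "\<forall>\<^sub>F n in F. \<forall>x\<in>B. norm (f n x - l x) \<le> e" using R by simp
    then show "\<forall>\<^sub>F n in F. f n \<in> U"
      by eventually_elim (use B(3) f in \<open>auto simp: dual_ball_def\<close>)
  qed
qed

lemma limitin_dual_pointwise:
  assumes f: "\<And>n. f n \<in> E'" and L: "limitin D f l F" and x: "x \<in> S"
  shows "((\<lambda>n. f n x) \<longlongrightarrow> l x) F"
proof (rule tendstoI)
  fix e :: real assume e: "0 < e"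
  have "\<forall>\<^sub>F n in F. \<forall>x\<in>{x}. norm (f n x - l x) \<le> e / 2"
    using limitin_dual[OF f, THEN iffD1, OF L, THEN conjunct2, rule_format,
        OF vn_bounded_singleton[OF x], of "e / 2"] e by simp
  then show "\<forall>\<^sub>F n in F. dist (f n x) (l x) < e"
    by eventually_elim (use e in \<open>auto simp: dist_norm\<close>)
qed

text \<open>Singletons are bounded, so a strongly bounded set of functionals is pointwise bounded,
  and barrelledness yields a common dominating seminorm.\<close>

lemma bounded_dual_imp_equicontinuous:
  assumes barrelled: "barrelled_space smul X" and H: "vn_bounded dual_scale D H"
  shows "\<exists>q. csn q \<and> (\<forall>u\<in>H. \<forall>x\<in>S. norm (u x) \<le> q x)"
proof -
  have HE: "H \<subseteq> E'" using H by (simp add: vn_bounded_def)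
  have "\<exists>q. csn q \<and> (\<forall>p\<in>(\<lambda>u x. norm (u x)) ` H. \<forall>x\<in>S. p x \<le> q x)"
  proof (rule barrelled_csn_bound[OF barrelled])
    show "csn p" if "p \<in> (\<lambda>u x. norm (u x)) ` H" for p
      using that csn_functional HE by auto
    fix x assume x: "x \<in> S"
    have "zero_nhd D (dual_ball smul X 0 {x} 1)"
      using vn_bounded_singleton[OF x] by (intro zero_nhd_dual_ball) auto
    then have "absorbs dual_scale (dual_ball smul X 0 {x} 1) H"
      using H by (simp add: vn_bounded_def)
    then obtain r where r: "r > 0"
      and sub: "\<And>c. r \<le> norm c \<Longrightarrow> H \<subseteq> dual_scale c ` dual_ball smul X 0 {x} 1"
      unfolding absorbs_def by blast
    have "norm (u x) \<le> r" if u: "u \<in> H" for u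
    proof -
      have "H \<subseteq> dual_scale (of_real r) ` dual_ball smul X 0 {x} 1" using r by (intro sub) simp
      then obtain v where v: "v \<in> dual_ball smul X 0 {x} 1" "u = dual_scale (of_real r) v"
        using u by blast
      then have "norm (v x) \<le> 1" by (simp add: dual_ball_def)
      then show ?thesis using v(2) r by (simp add: dual_scale_def norm_mult)
    qed
    then show "\<exists>C. \<forall>p\<in>(\<lambda>u x. norm (u x)) ` H. p x \<le> C" by blast
  qed
  then show ?thesis by simp
qed

text \<open>Strongly bounded sets of functionals are equicontinuous, so uniform convergence of the means
  on bounded sets dualises to uniform convergence on bounded sets.\<close>

lemma uniformly_mean_ergodic_dual:
  assumes barrelled: "barrelled_space smul X" and T: "T \<in> operators"
    and erg: "uniformly_mean_ergodic smul X T"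
  shows "uniformly_mean_ergodic dual_scale D (transpose_operator X T)"
proof -
  obtain P where P: "P \<in> operators"
    and unif: "\<And>B V. vn_bounded smul X B \<Longrightarrow> zero_nhd X V \<Longrightarrow>
      \<forall>\<^sub>F n in sequentially. \<forall>x\<in>B. mean T n x - P x \<in> V"
    using erg unfolding uniformly_mean_ergodic_def by blast
  \<comment> \<open>Stated for any set \<open>H\<close> dominated by one seminorm, this covers both
    the singletons needed for pointwise convergence and the strongly bounded sets.\<close>
  have key: "\<forall>\<^sub>F n in sequentially. \<forall>u\<in>H. \<forall>x\<in>B.
      norm (dual_mean T n u x - transpose_operator X P u x) \<le> e"
    if H: "H \<subseteq> E'" and q: "csn q" "\<forall>u\<in>H. \<forall>x\<in>S. norm (u x) \<le> q x"
      and B: "vn_bounded smul X B" and e: "0 < e" for H q B e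
  proof -
    have BS: "B \<subseteq> S" using B by (simp add: vn_bounded_def)
    have "zero_nhd X {x \<in> S. q x < e}" using e by (intro zero_nhdI_csn[OF q(1)]) auto
    from unif[OF B this] show ?thesis
    proof eventually_elim
      case (elim n)
      show ?case
      proof (intro ballI)
        fix u x assume u: "u \<in> H" and "x \<in> B"
        then have x: "x \<in> S" and uE: "u \<in> E'" and d: "mean T n x - P x \<in> S" "q (mean T n x - P x) < e"
          using BS H elim by auto
        have "dual_mean T n u x - transpose_operator X P u x = u (mean T n x - P x)"
          using functional_diff[OF uE operator_closed[OF mean_operator[OF T] x] operator_closed[OF P x]]
          by (simp add: dual_mean_apply[OF T uE x] transpose_apply[OF x])
        then show "norm (dual_mean T n u x - transpose_operator X P u x) \<le> e"
          using q(2) u d by fastforce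
      qed
    qed
  qed
  have "limitin D (\<lambda>n. dual_mean T n u) (transpose_operator X P u) sequentially"
    if u: "u \<in> E'" for u
    unfolding limitin_dual[OF dual_mean_closed[OF T u]]
  proof (intro conjI allI impI)
    show "transpose_operator X P u \<in> E'" using transpose_closed[OF P u] .
    fix B and e :: real assume "vn_bounded smul X B" "0 < e"
    then show "\<forall>\<^sub>F n in sequentially. \<forall>x\<in>B.
        norm (dual_mean T n u x - transpose_operator X P u x) \<le> e"
      using key[of "{u}" "\<lambda>x. norm (u x)" B e] u csn_functional[OF u] by simp
  qed
  moreover have "\<forall>\<^sub>F n in sequentially. \<forall>u\<in>H. dual_mean T n u - transpose_operator X P u \<in> V"
    if H: "vn_bounded dual_scale D H" and V: "zero_nhd D V" for H V
  proof -
    obtain B e where B: "vn_bounded smul X B" "0 < e" "dual_ball smul X 0 B e \<subseteq> V"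
      using zero_nhd_dual[OF V] by (elim exE conjE)
    have HE: "H \<subseteq> E'" using H by (simp add: vn_bounded_def)
    obtain q where q: "csn q" "\<forall>u\<in>H. \<forall>x\<in>S. norm (u x) \<le> q x"
      using bounded_dual_imp_equicontinuous[OF barrelled H] by (elim exE conjE)
    from key[OF HE q B(1,2)] show ?thesis
    proof eventually_elim
      case (elim n)
      show ?case
      proof
        fix u assume u: "u \<in> H"
        then have "dual_mean T n u - transpose_operator X P u \<in> E'"
          using HE by (intro dual_minus dual_mean_closed[OF T] transpose_closed[OF P]) auto
        then have "dual_mean T n u - transpose_operator X P u \<in> dual_ball smul X 0 B e"
          using elim u by (simp add: dual_ball_def)
        then show "dual_mean T n u - transpose_operator X P u \<in> V" using B(3) by blast
      qed
    qed
  qed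
  ultimately show ?thesis
    unfolding uniformly_mean_ergodic_def topspace_strong_dual
    using transpose_operator_dual[OF P] by blast
qed

text \<open>Evaluation at \<open>x\<close> makes u(M_n x) convergent, hence bounded. By
  \<open>mean_Suc\<close>, the scaled powers are differences of two sequences with this same limit,
  because n / (n + 1) tends to 1.\<close>

lemma dual_mean_ergodic_imp_weak:
  assumes T: "T \<in> operators" and erg: "mean_ergodic dual_scale D (transpose_operator X T)"
    and u: "u \<in> E'" and x: "x \<in> S"
  shows "\<exists>C. \<forall>n. norm (u (mean T n x)) \<le> C"
    and "(\<lambda>n. u (smul (1 / of_nat n) ((T ^^ n) x))) \<longlonglongrightarrow> 0"
proof -
  obtain Q where "limitin D (\<lambda>n. dual_mean T n u) (Q u) sequentially"
    using erg u unfolding mean_ergodic_def topspace_strong_dual by blast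
  then have lim: "(\<lambda>n. u (mean T n x)) \<longlonglongrightarrow> Q u x"
    using limitin_dual_pointwise[OF dual_mean_closed[OF T u] _ x] by (simp add: dual_mean_apply[OF T u x])
  then show "\<exists>C. \<forall>n. norm (u (mean T n x)) \<le> C"
    using convergent_imp_Bseq[of "\<lambda>n. u (mean T n x)"] unfolding convergent_def Bseq_def by blast
  have M: "mean T n x \<in> S" for n using operator_closed[OF mean_operator[OF T] x] .
  have "u (smul (1 / of_nat (Suc n)) ((T ^^ Suc n) x)) =
      u (mean T (Suc n) x) - of_nat n / of_nat (Suc n) * u (mean T n x)" for n
    unfolding mean_Suc using functional_diff[OF u] functional_scale[OF u] M by simp
  moreover have "(\<lambda>n. u (mean T (Suc n) x) - of_nat n / of_nat (Suc n) * u (mean T n x))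
      \<longlonglongrightarrow> Q u x - 1 * Q u x"
    by (intro tendsto_diff tendsto_mult lim LIMSEQ_Suc[OF lim] LIMSEQ_n_over_Suc_n)
  ultimately have "(\<lambda>n. u (smul (1 / of_nat (Suc n)) ((T ^^ Suc n) x))) \<longlonglongrightarrow> 0"
    by simp
  then show "(\<lambda>n. u (smul (1 / of_nat n) ((T ^^ n) x))) \<longlonglongrightarrow> 0"
    by (rule LIMSEQ_imp_Suc)
qed

lemma dual_power_closed:
  assumes "T \<in> operators" "u \<in> E'"
  shows "dual_scale c ((transpose_operator X T ^^ n) u) \<in> E'"
  using dual_scale_closed[OF transpose_funpow_closed[OF assms]] .

lemma dual_power_apply:
  assumes T: "T \<in> operators" and u: "u \<in> E'" and x: "x \<in> S"
  shows "dual_scale c ((transpose_operator X T ^^ n) u) x = u (smul c ((T ^^ n) x))"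
  using functional_scale[OF u operator_closed[OF operator_funpow[OF T] x]]
  by (simp add: dual_scale_def transpose_funpow_apply[OF T x])

text \<open>Evaluation at \<open>x\<close> is continuous on the strong dual, so equicontinuity
  bounds it after all transposed means on some neighbourhood of 0, and a multiple of
  \<open>u\<close> lies in that neighbourhood.\<close>

lemma dual_cesaro_bounded_imp_weak:
  assumes T: "T \<in> operators" and cb: "cesaro_bounded dual_scale D (transpose_operator X T)"
    and u: "u \<in> E'" and x: "x \<in> S"
  shows "\<exists>C. \<forall>n. norm (u (mean T n x)) \<le> C"
proof -
  have nhd: "zero_nhd D (dual_ball smul X 0 {x} 1)"
    using vn_bounded_singleton[OF x] by (intro zero_nhd_dual_ball) auto
  obtain U where U: "zero_nhd D U"
    and "\<forall>A\<in>{dual_mean T n |n. 1 \<le> n}. A ` U \<subseteq> dual_ball smul X 0 {x} 1"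
    using cb[unfolded cesaro_bounded_def equicontinuous_operators_def, THEN conjunct2,
        THEN spec, THEN mp, OF nhd] by (elim exE conjE)
  then have sub: "dual_mean T n ` U \<subseteq> dual_ball smul X 0 {x} 1" if "1 \<le> n" for n
    using that by auto
  obtain B e where B: "vn_bounded smul X B" "0 < e" "dual_ball smul X 0 B e \<subseteq> U"
    using zero_nhd_dual[OF U] by (elim exE conjE)
  obtain K where K: "\<And>y. y \<in> B \<Longrightarrow> norm (u y) \<le> K"
    using vn_bounded_csn[OF B(1) csn_functional[OF u]] by blast
  \<comment> \<open>Chosen so that \<open>c\<close> times \<open>u\<close> is at most
    \<open>e\<close> on \<open>B\<close>; the absolute value and the summand 1 keep the denominator
    positive, since \<open>K\<close> may be 0 or, for empty \<open>B\<close>, negative.\<close>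
  define c where "c = e / (\<bar>K\<bar> + 1)"
  have c: "0 < c" "c * (\<bar>K\<bar> + 1) = e" using B(2) by (simp_all add: c_def)
  have cE: "dual_scale (of_real c) u \<in> E'" using dual_scale_closed[OF u] .
  have "norm (of_real c * u y) \<le> e" if y: "y \<in> B" for y
  proof -
    have "c * norm (u y) \<le> c * (\<bar>K\<bar> + 1)"
      using K[OF y] c(1) by (intro mult_left_mono) auto
    then show ?thesis using c by (simp add: norm_mult)
  qed
  then have "dual_scale (of_real c) u \<in> U"
    using B(3) cE by (auto simp: dual_ball_def dual_scale_def)
  then have "norm (of_real c * u (mean T n x)) \<le> 1" if "1 \<le> n" for n
    using sub[OF that] dual_mean_apply[OF T cE x, of n]
    by (force simp: dual_ball_def dual_scale_def)
  then have "norm (u (mean T n x)) \<le> 1 / c" if "1 \<le> n" for n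
    using that c(1) by (simp add: norm_mult field_simps)
  moreover have "norm (u (mean T 0 x)) \<le> 1 / c"
    using c(1) by (simp add: mean_0 functional_0[OF u])
  ultimately have "norm (u (mean T n x)) \<le> 1 / c" for n
    by (cases "n = 0") auto
  then show ?thesis by blast
qed

end

context montel
begin

text \<open>Equicontinuity of the means makes the union of all M_n(B) bounded, and every transposed
  mean maps the dual ball over this union into the ball of the same radius over
  \<open>B\<close>.\<close>

lemma cesaro_bounded_dual:
  assumes T: "T \<in> operators" and cb: "cesaro_bounded smul X T"
  shows "cesaro_bounded dual_scale D (transpose_operator X T)"
  unfolding cesaro_bounded_def equicontinuous_operators_def
proof (intro conjI allI impI)
  show "{dual_mean T n |n. 1 \<le> n} \<subseteq> continuous_operators dual_scale D"
    using dual_mean_operator[OF T] by auto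
  fix V assume V: "zero_nhd D V"
  obtain B e where B: "vn_bounded smul X B" "0 < e" "dual_ball smul X 0 B e \<subseteq> V"
    using zero_nhd_dual[OF V] by (elim exE conjE)
  have BS: "B \<subseteq> S" using B by (simp add: vn_bounded_def)
  let ?C = "\<Union>n. mean T n ` B"
  have "vn_bounded smul X ?C"
    unfolding vn_bounded_iff_csn
  proof (intro conjI allI impI)
    show "?C \<subseteq> S" using operator_closed[OF mean_operator[OF T]] BS by auto
    fix p assume p: "csn p"
    obtain q where q: "csn q" "\<forall>n. \<forall>x\<in>S. p (mean T n x) \<le> q x"
      using cesaro_bounded_imp_csn[OF cb p] by (elim exE conjE)
    obtain K where "\<forall>x\<in>B. q x \<le> K" using vn_bounded_csn[OF B(1) q(1)] by (elim exE)
    then have "p (mean T n x) \<le> K" if "x \<in> B" for n x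
      using q(2) that BS by (meson order_trans subsetD)
    then show "\<exists>K. \<forall>y\<in>?C. p y \<le> K" by (intro exI[of _ K]) auto
  qed
  then have "zero_nhd D (dual_ball smul X 0 ?C e)" using B(2) by (rule zero_nhd_dual_ball)
  moreover have "dual_mean T n ` dual_ball smul X 0 ?C e \<subseteq> V" for n
  proof clarify
    fix u assume u: "u \<in> dual_ball smul X 0 ?C e"
    then have uE: "u \<in> E'" by (simp add: dual_ball_def)
    have "norm (dual_mean T n u x) \<le> e" if "x \<in> B" for x
      using u that BS dual_mean_apply[OF T uE, of x n] by (auto simp: dual_ball_def)
    then have "dual_mean T n u \<in> dual_ball smul X 0 B e"
      using dual_mean_closed[OF T uE] by (simp add: dual_ball_def)
    then show "dual_mean T n u \<in> V" using B(3) by blast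
  qed
  ultimately show "\<exists>U. zero_nhd D U \<and> (\<forall>A\<in>{dual_mean T n |n. 1 \<le> n}. A ` U \<subseteq> V)"
    by (intro exI[of _ "dual_ball smul X 0 ?C e"]) auto
qed

text \<open>Strong convergence to 0 means that u(T^n x / n) tends to 0 uniformly on bounded sets,
  which is uniform convergence of T^n / n measured by the modulus of \<open>u\<close>.\<close>

lemma dual_power_limit:
  assumes T: "T \<in> operators" and cb: "cesaro_bounded smul X T"
    and pow: "\<And>x. x \<in> S \<Longrightarrow> limitin X (\<lambda>n. smul (1 / of_nat n) ((T ^^ n) x)) 0 sequentially"
    and u: "u \<in> E'"
  shows "limitin D (\<lambda>n. dual_scale (1 / of_nat n) ((transpose_operator X T ^^ n) u)) 0 sequentially"
  unfolding limitin_dual[of "\<lambda>n. dual_scale (1 / of_nat n) ((transpose_operator X T ^^ n) u)",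
      OF dual_power_closed[OF T u]]
proof (intro conjI allI impI)
  show "0 \<in> E'" by (rule dual_zero)
  fix B and e :: real assume B: "vn_bounded smul X B" and e: "0 < e"
  have BS: "B \<subseteq> S" using B by (simp add: vn_bounded_def)
  have "\<forall>\<^sub>F n in sequentially. \<forall>x\<in>B. norm (u (smul (1 / of_nat n) ((T ^^ n) x))) < e"
    by (rule power_uniform[OF T cb _ B csn_functional[OF u] e]) (rule pow)
  then show "\<forall>\<^sub>F n in sequentially. \<forall>x\<in>B.
      norm (dual_scale (1 / of_nat n) ((transpose_operator X T ^^ n) u) x - 0 x) \<le> e"
  proof eventually_elim
    case (elim n)
    show ?case
    proof
      fix x assume x: "x \<in> B"
      then have "x \<in> S" using BS by blast
      then show "norm (dual_scale (1 / of_nat n) ((transpose_operator X T ^^ n) u) x - 0 x) \<le> e"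
        using elim x by (simp add: dual_power_apply[OF T u] less_imp_le)
    qed
  qed
qed

end

theorem theorem2p5:
  fixes smul :: "'k::real_or_complex \<Rightarrow> 'a::ab_group_add \<Rightarrow> 'a"
    and X :: "'a topology"
    and T :: "'a \<Rightarrow> 'a"
  assumes "montel_space smul X"
    and "T \<in> continuous_operators smul X"
  shows "(mean_ergodic smul X T \<longleftrightarrow> uniformly_mean_ergodic smul X T) \<and>
    (((cesaro_bounded smul X T \<and>
       (\<forall>x\<in>topspace X. limitin X (\<lambda>n. smul (1 / of_nat n) ((T ^^ n) x)) 0 sequentially))
      \<longleftrightarrow> mean_ergodic smul X T) \<and>
     (mean_ergodic smul X T \<longleftrightarrow> uniformly_mean_ergodic smul X T) \<and>
     (uniformly_mean_ergodic smul X T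
      \<longleftrightarrow> mean_ergodic dual_scale (strong_dual smul X) (transpose_operator X T)) \<and>
     (mean_ergodic dual_scale (strong_dual smul X) (transpose_operator X T)
      \<longleftrightarrow> uniformly_mean_ergodic dual_scale (strong_dual smul X) (transpose_operator X T)) \<and>
     (uniformly_mean_ergodic dual_scale (strong_dual smul X) (transpose_operator X T)
      \<longleftrightarrow> (cesaro_bounded dual_scale (strong_dual smul X) (transpose_operator X T) \<and>
          (\<forall>u\<in>dual_space smul X.
             limitin (strong_dual smul X)
               (\<lambda>n. dual_scale (1 / of_nat n) ((transpose_operator X T ^^ n) u)) 0 sequentially))))"
proof -
  have lc: "lc_hausdorff_space smul X"
    using assms(1) by (simp add: montel_space_def barrelled_space_def)
  then interpret vector_space smul by (simp add: lc_hausdorff_space_def)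
  interpret montel smul X by unfold_locales (rule lc assms(1))+
  note T = assms(2)
  let ?i = "cesaro_bounded smul X T \<and>
    (\<forall>x\<in>S. limitin X (\<lambda>n. smul (1 / of_nat n) ((T ^^ n) x)) 0 sequentially)"
  let ?ii = "mean_ergodic smul X T"
  let ?iii = "uniformly_mean_ergodic smul X T"
  let ?iv = "mean_ergodic dual_scale D (transpose_operator X T)"
  let ?v = "uniformly_mean_ergodic dual_scale D (transpose_operator X T)"
  let ?vi = "cesaro_bounded dual_scale D (transpose_operator X T) \<and> (\<forall>u\<in>E'. limitin D
    (\<lambda>n. dual_scale (1 / of_nat n) ((transpose_operator X T ^^ n) u)) 0 sequentially)"
  have 1: "?i \<Longrightarrow> ?iii"
    using cesaro_bounded_imp_uniformly_mean_ergodic[OF T] by simp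
  have 2: "?iii \<Longrightarrow> ?ii" "?v \<Longrightarrow> ?iv"
    by (auto simp: uniformly_mean_ergodic_def mean_ergodic_def)
  have 3: "?ii \<Longrightarrow> ?i"
    using mean_ergodic_imp_cesaro_bounded[OF barrelled T] by simp
  have 4: "?iii \<Longrightarrow> ?v"
    using uniformly_mean_ergodic_dual[OF barrelled T] .
  have 5: "?iv \<Longrightarrow> ?i"
    using weak_imp_cesaro_bounded[OF T] dual_mean_ergodic_imp_weak[OF T] by simp
  have 6: "?i \<Longrightarrow> ?vi"
    using cesaro_bounded_dual[OF T] dual_power_limit[OF T] by simp
  have 7: "?vi \<Longrightarrow> ?i"
  proof -
    assume vi: ?vi
    have "(\<lambda>n. u (smul (1 / of_nat n) ((T ^^ n) x))) \<longlonglongrightarrow> 0" if u: "u \<in> E'" and x: "x \<in> S" for u x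
      using limitin_dual_pointwise[of "\<lambda>n. dual_scale (1 / of_nat n) ((transpose_operator X T ^^ n) u)"
          0 sequentially x] dual_power_closed[OF T u] vi u x
      by (simp add: dual_power_apply[OF T u x])
    then show ?i
      using weak_imp_cesaro_bounded[OF T] dual_cesaro_bounded_imp_weak[OF T] vi by simp
  qed
  \<comment> \<open>Every cycle passes through \<open>?i\<close>: from \<open>?i\<close> to
    \<open>?iii\<close>, \<open>?ii\<close> and back; from \<open>?iii\<close> to \<open>?v\<close>,
    \<open>?iv\<close> and \<open>?i\<close>; and between \<open>?i\<close> and
    \<open>?vi\<close>.\<close>
  show ?thesis using 1 2 3 4 5 6 7 by argo
qed

end
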